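(* Let $n_0\ge 2$ be a fixed integer and consider $n=Tn_0$ with $n\to\infty$, so that $T\to\infty$. For each such $n$ let $\{(\mathbf{x}_i,y_i)\}_{i=1}^n$ be generated by the $k$-sample linear regression model described in the context, where $n_0$ divides every sample size $n_j$, and the predictor, the intercept and the error are mutually independent. Assume that the $\mathbf{x}_i$ are i.i.d. (copies of $\mathbf{x}$) with $\mathbb{E}[\|\mathbf{x}\|^3]<\infty$ and that $\bm{\Sigma}_{\mathbf{xx}}=\mathrm{Var}(\mathbf{x})$ is positive definite. Let the block length $w=w(n)$, with $n_0<w\le n$, satisfy, as $n\to\infty$, $$w\to\infty,\qquad w=o(n),\qquad \frac{w}{\log n}\to\infty.$$ Then the EMMB estimators $\hat{\overline{\mu}}$ and $\hat{\underline{\mu}}$ are consistent for the $w$-robust upper bound $\overline{\mu}_w$ and the $w$-robust lower bound $\underline{\mu}_w$, respectively: $$\hat{\overline{\mu}}-\overline{\mu}_w\xrightarrow{P}0\quad\text{and}\quad\hat{\underline{\mu}}-\underline{\mu}_w\xrightarrow{P}0\quad\text{as } n\to\infty.$$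
   Context: Model. The observations satisfy $y_i=\mathbf{x}_i^{\top}\bm{\beta}+\nu_i+\varepsilon_i$, $i=1,\dots,n$, with $\bm{\beta}\in\mathbb{R}^p$, predictors $\mathbf{x}_i\in\mathbb{R}^p$ having distribution $F_{\mathbf{x}}$, and the pairs $(\mathbf{x}_i,y_i)$ independent across $i$. The data consist of $k$ consecutive samples (groups), the $j$th of size $n_j$, with $\sum_{j=1}^k n_j=n$. For every index $i$ in the $j$th sample, $\nu_i=c_j$ (a one-point distribution), with $c_j\in[\underline{\mu},\overline{\mu}]$, $\underline{\mu}=\min_{1\le j\le k} c_j$, $\overline{\mu}=\max_{1\le j\le k} c_j$, and $\varepsilon_i\sim\mathcal{N}(0,\sigma_j^2)$ with $\sigma_j\in[\underline{\sigma},\overline{\sigma}]$, $0<\underline{\sigma}\le\overline{\sigma}<\infty$. For each $i$, $\mathbf{x}_i,\nu_i,\varepsilon_i$ are mutually independent. As $n\to\infty$, the quantities $p$, $\bm{\beta}$, $F_{\mathbf{x}}$, $\underline{\mu},\overline{\mu},\underline{\sigma},\overline{\sigma}$ are fixed, while $k$, $n_j$, $c_j$, $\sigma_j$ may depend on $n$. Windows. The window size $n_0$ satisfies $n_0<\min_{1\le j\le k} n_j$, and $T=n/n_0$. The $j$th window is the index set $\{1+(j-1)n_0,\dots,jn_0\}$, $1\le j\le T$. Put $\bar{\mathbf{x}}_j=\frac1{n_0}\sum_{i=1+(j-1)n_0}^{jn_0}\mathbf{x}_i$ and $$\mathbf{W}=\sum_{j=1}^{T}\sum_{i=1+(j-1)n_0}^{jn_0}(\mathbf{x}_i-\bar{\mathbf{x}}_j)(\mathbf{x}_i-\bar{\mathbf{x}}_j)^{\top}.$$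 EM estimator (first step of EMMB). The algorithm alternates: (E-step) given $\bm{\beta}^{(s)}$, set $a_j=\frac1{n_0}\sum_{i=1+(j-1)n_0}^{jn_0}(y_i-\mathbf{x}_i^{\top}\bm{\beta}^{(s)})$ and $\nu_i^{(s+1)}=a_j$ for all $i$ in window $j$; (M-step) let $\bm{\beta}^{(s+1)}$ minimize $\sum_{i=1}^n\{y_i-(\mathbf{x}_i^{\top}\bm{\beta}+\nu_i^{(s+1)})\}^2$ over $\bm{\beta}$, i.e. solve $\sum_{i=1}^n\{y_i-(\mathbf{x}_i^{\top}\bm{\beta}^{(s+1)}+\nu_i^{(s+1)})\}\mathbf{x}_i=\mathbf{0}$. The EM estimator $\hat{\bm{\beta}}_{\mathrm{EM}}$ is the value upon convergence, i.e. the vector which together with numbers $\hat a_1,\dots,\hat a_T$ satisfies both $$\sum_{i=1+(j-1)n_0}^{jn_0}(y_i-\hat a_j-\mathbf{x}_i^{\top}\hat{\bm{\beta}}_{\mathrm{EM}})=0\ (1\le j\le T),\qquad \sum_{j=1}^T\sum_{i=1+(j-1)n_0}^{jn_0}(y_i-\hat a_j-\mathbf{x}_i^{\top}\hat{\bm{\beta}}_{\mathrm{EM}})\mathbf{x}_i=\mathbf{0}.$$ It is uniquely determined when $\mathbf{W}$ is invertible; on the event that $\mathbf{W}$ is singular it is given an arbitrary (measurable) value. Moving blocks (second step of EMMB). Let $L=n-w+1$ and, for $1\le l\le L$, let the $l$th block $B_l=\{(\mathbf{x}_i,y_i)\}_{i=l}^{l+w-1}$. Let $a_l$ (block version) solve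 $\sum_{i=l}^{l+w-1}\{y_i-(\mathbf{x}_i^{\top}\hat{\bm{\beta}}_{\mathrm{EM}}+a_l)\}=0$. The EMMB estimators are $\hat{\underline{\mu}}=\min_{1\le l\le L}a_l$ and $\hat{\overline{\mu}}=\max_{1\le l\le L}a_l$. $w$-robust bounds. With $\mu(B_l)=\frac1w\sum_{i=l}^{l+w-1}\mathbb{E}[\nu_i]$ (where $\nu_i=c_j$ if observation $i$ belongs to the $j$th sample), define $\overline{\mu}_w=\max_{1\le l\le L}\mu(B_l)$ and $\underline{\mu}_w=\min_{1\le l\le L}\mu(B_l)$; these depend on $n$. *)

theory Defs
  imports "HOL-Probability.Probability" "HOL-Library.Landau_Symbols"
begin

(* Mutual independence of three random variables with different value spaces; this is what
   indep_vars unfolds to, except that indep_vars requires a common value type. *)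
definition (in prob_space) indep_triple ::
    "'b measure \<Rightarrow> ('a \<Rightarrow> 'b) \<Rightarrow> 'c measure \<Rightarrow> ('a \<Rightarrow> 'c) \<Rightarrow> 'd measure \<Rightarrow> ('a \<Rightarrow> 'd) \<Rightarrow> bool" where
  "indep_triple N1 X1 N2 X2 N3 X3 \<longleftrightarrow>
     random_variable N1 X1 \<and> random_variable N2 X2 \<and> random_variable N3 X3 \<and>
     indep_sets (\<lambda>m::nat. if m = 1 then {X1 -` A \<inter> space M | A. A \<in> sets N1}
                         else if m = 2 then {X2 -` A \<inter> space M | A. A \<in> sets N2}
                         else {X3 -` A \<inter> space M | A. A \<in> sets N3}) {1, 2, 3}"

definition covariance_matrix :: "(real ^ 'p) measure \<Rightarrow> real ^ 'p ^ 'p" where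
  "covariance_matrix F =
     (\<chi> a b. \<integral>v. (v $ a - (\<integral>u. u $ a \<partial>F)) * (v $ b - (\<integral>u. u $ b \<partial>F)) \<partial>F)"

definition positive_definite :: "real ^ 'p ^ 'p \<Rightarrow> bool" where
  "positive_definite A \<longleftrightarrow> transpose A = A \<and> (\<forall>v. v \<noteq> 0 \<longrightarrow> v \<bullet> (A *v v) > 0)"

(* Convergence to 0 in probability for a sequence in which Z T may live on its own
   probability space M T. *)
definition conv_prob_zero :: "(nat \<Rightarrow> 'a measure) \<Rightarrow> (nat \<Rightarrow> 'a \<Rightarrow> real) \<Rightarrow> bool" where
  "conv_prob_zero M Z \<longleftrightarrow>
     (\<forall>\<^sub>F T in sequentially. Z T \<in> borel_measurable (M T)) \<and>
     (\<forall>e>0. (\<lambda>T. measure (M T) {\<omega> \<in> space (M T). \<bar>Z T \<omega>\<bar> > e}) \<longlonglongrightarrow> 0)"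

(* Observations, samples, windows and blocks are all numbered from 1. *)
definition sample_indices :: "(nat \<Rightarrow> nat) \<Rightarrow> nat \<Rightarrow> nat set" where
  "sample_indices N j = {(\<Sum>l=1..<j. N l) + 1 .. (\<Sum>l=1..j. N l)}"

definition window :: "nat \<Rightarrow> nat \<Rightarrow> nat set" where
  "window n0 j = {1 + (j - 1) * n0 .. j * n0}"

locale k_sample_regression = prob_space M
  for M :: "'a measure"
    and n :: nat and k :: nat and N :: "nat \<Rightarrow> nat"
    and c :: "nat \<Rightarrow> real" and \<sigma> :: "nat \<Rightarrow> real"
    and F :: "(real ^ 'p) measure" and \<beta> :: "real ^ 'p"
    and mu_lo :: real and mu_hi :: real and sigma_lo :: real and sigma_hi :: real
    and x :: "nat \<Rightarrow> 'a \<Rightarrow> real ^ 'p"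
    and \<nu> :: "nat \<Rightarrow> 'a \<Rightarrow> real" and \<epsilon> :: "nat \<Rightarrow> 'a \<Rightarrow> real"
    and y :: "nat \<Rightarrow> 'a \<Rightarrow> real" +
  assumes k_pos: "1 \<le> k"
    and total_size: "(\<Sum>j=1..k. N j) = n"
    and mu_lo: "mu_lo = Min (c ` {1..k})"
    and mu_hi: "mu_hi = Max (c ` {1..k})"
    and sigma_bounds: "0 < sigma_lo" "sigma_lo \<le> sigma_hi"
    and sigma_mem: "\<And>j. j \<in> {1..k} \<Longrightarrow> \<sigma> j \<in> {sigma_lo..sigma_hi}"
    and response: "\<And>i \<omega>. i \<in> {1..n} \<Longrightarrow> \<omega> \<in> space M \<Longrightarrow> y i \<omega> = x i \<omega> \<bullet> \<beta> + \<nu> i \<omega> + \<epsilon> i \<omega>"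
    and indep_within: "\<And>i. i \<in> {1..n} \<Longrightarrow> indep_triple borel (x i) borel (\<nu> i) borel (\<epsilon> i)"
    and indep_across: "indep_vars (\<lambda>_. borel) (\<lambda>i \<omega>. (x i \<omega>, y i \<omega>)) {1..n}"
    and x_distr: "\<And>i. i \<in> {1..n} \<Longrightarrow> distr M borel (x i) = F"
    and nu_distr: "\<And>j i. j \<in> {1..k} \<Longrightarrow> i \<in> sample_indices N j \<Longrightarrow>
                     distr M borel (\<nu> i) = return borel (c j)"
    and eps_distr: "\<And>j i. j \<in> {1..k} \<Longrightarrow> i \<in> sample_indices N j \<Longrightarrow>
                     distributed M lborel (\<epsilon> i) (normal_density 0 (\<sigma> j))"

definition window_mean :: "nat \<Rightarrow> (nat \<Rightarrow> real ^ 'p) \<Rightarrow> nat \<Rightarrow> real ^ 'p" where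
  "window_mean n0 x j = (1 / real n0) *\<^sub>R (\<Sum>i\<in>window n0 j. x i)"

definition outer_prod :: "real ^ 'p \<Rightarrow> real ^ 'p \<Rightarrow> real ^ 'p ^ 'p" where
  "outer_prod u v = (\<chi> a b. u $ a * v $ b)"

definition within_scatter :: "nat \<Rightarrow> nat \<Rightarrow> (nat \<Rightarrow> real ^ 'p) \<Rightarrow> real ^ 'p ^ 'p" where
  "within_scatter n0 T x = (\<Sum>j=1..T. \<Sum>i\<in>window n0 j.
     outer_prod (x i - window_mean n0 x j) (x i - window_mean n0 x j))"

(* b is a fixed point of the EM iteration, with window intercepts a. *)
definition is_EM_solution ::
    "nat \<Rightarrow> nat \<Rightarrow> (nat \<Rightarrow> real ^ 'p) \<Rightarrow> (nat \<Rightarrow> real) \<Rightarrow> real ^ 'p \<Rightarrow> bool" where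
  "is_EM_solution n0 T x y b \<longleftrightarrow>
     (\<exists>a :: nat \<Rightarrow> real.
        (\<forall>j\<in>{1..T}. (\<Sum>i\<in>window n0 j. y i - a j - x i \<bullet> b) = 0) \<and>
        (\<Sum>j=1..T. \<Sum>i\<in>window n0 j. (y i - a j - x i \<bullet> b) *\<^sub>R x i) = 0)"

definition block_intercept ::
    "nat \<Rightarrow> (nat \<Rightarrow> real ^ 'p) \<Rightarrow> (nat \<Rightarrow> real) \<Rightarrow> real ^ 'p \<Rightarrow> nat \<Rightarrow> real" where
  "block_intercept w x y b l = (THE a. (\<Sum>i=l..l+w-1. y i - (x i \<bullet> b + a)) = 0)"

lemma block_intercept_eq:
  assumes "w > 0"
  shows "block_intercept w x y b l = (\<Sum>i=l..l+w-1. y i - x i \<bullet> b) / real w"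
proof -
  have "(\<Sum>i=l..l+w-1. y i - (x i \<bullet> b + a)) = (\<Sum>i=l..l+w-1. y i - x i \<bullet> b) - real w * a" for a
    using assms by (simp add: sum.distrib sum_subtractf)
  then have "(\<Sum>i=l..l+w-1. y i - (x i \<bullet> b + a)) = 0 \<longleftrightarrow>
      a = (\<Sum>i=l..l+w-1. y i - x i \<bullet> b) / real w" for a
    using assms by (simp only: eq_divide_eq) (auto simp: mult.commute)
  then show ?thesis
    unfolding block_intercept_def by simp
qed

definition EMMB_upper ::
    "nat \<Rightarrow> nat \<Rightarrow> (nat \<Rightarrow> real ^ 'p) \<Rightarrow> (nat \<Rightarrow> real) \<Rightarrow> real ^ 'p \<Rightarrow> real" where
  "EMMB_upper n w x y b = Max (block_intercept w x y b ` {1..n - w + 1})"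

definition EMMB_lower ::
    "nat \<Rightarrow> nat \<Rightarrow> (nat \<Rightarrow> real ^ 'p) \<Rightarrow> (nat \<Rightarrow> real) \<Rightarrow> real ^ 'p \<Rightarrow> real" where
  "EMMB_lower n w x y b = Min (block_intercept w x y b ` {1..n - w + 1})"

definition block_mu :: "'a measure \<Rightarrow> nat \<Rightarrow> (nat \<Rightarrow> 'a \<Rightarrow> real) \<Rightarrow> nat \<Rightarrow> real" where
  "block_mu M w \<nu> l = (1 / real w) * (\<Sum>i=l..l+w-1. (\<integral>\<omega>. \<nu> i \<omega> \<partial>M))"

definition robust_upper :: "'a measure \<Rightarrow> nat \<Rightarrow> nat \<Rightarrow> (nat \<Rightarrow> 'a \<Rightarrow> real) \<Rightarrow> real" where
  "robust_upper M n w \<nu> = Max (block_mu M w \<nu> ` {1..n - w + 1})"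

definition robust_lower :: "'a measure \<Rightarrow> nat \<Rightarrow> nat \<Rightarrow> (nat \<Rightarrow> 'a \<Rightarrow> real) \<Rightarrow> real" where
  "robust_lower M n w \<nu> = Min (block_mu M w \<nu> ` {1..n - w + 1})"

end

theory Submission
  imports Defs
begin

text \<open>
Why the theorem holds. Write \<open>e i = y i - x i \<bullet> \<beta> - E (\<nu> i)\<close>. Almost surely this is the error
\<open>\<epsilon> i\<close>, but being a function of \<open>(x i, y i)\<close> it is independent over \<open>i\<close>. The block intercepts satisfy

  \<open>a l - \<mu> (B l) = mean of e over B l - (mean of x over B l) \<bullet> (b - \<beta>)\<close>

with \<open>b\<close> the EM estimate, and \<open>Max\<close> and \<open>Min\<close> are Lipschitz for the uniform distance. So it is enough
that both terms on the right tend to \<open>0\<close> in probability, uniformly over the blocks.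

The first term is a centred Gaussian of variance at most \<open>sigma_hi\<^sup>2 / w\<close>. There are at most \<open>n\<close>
blocks, so the union bound costs \<open>2 n exp (- c w)\<close>, and \<open>w / ln n \<rightarrow> \<infinity>\<close> makes this vanish.

For the second term, the sample boundaries are multiples of \<open>n0\<close>, so the mean intercept is constant
on every window. The fixed-point equations of the EM iteration then reduce to
\<open>Q (b - \<beta>) = (b - \<beta>) \<bullet> g\<close>, where \<open>Q\<close> is the quadratic form of the within-window scatter and
\<open>g\<close> is the sum of \<open>e i *\<^sub>R (x i - window mean)\<close> (lemma \<open>EM_solution_form_eq_score\<close>).

  \<^item> \<open>Q v \<ge> \<kappa> T |v|\<^sup>2\<close> outside an event of probability \<open>O(1/T)\<close>. A window contributes at least half of
    \<open>(v \<bullet> d)\<^sup>2\<close>, with \<open>d\<close> the difference of its first two predictors. Replacing \<open>d\<close> by the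
    bounded vector \<open>d / sqrt (1 + |d|\<^sup>2)\<close> only lowers the form, keeps its expectation positive definite,
    and lets Chebyshev's inequality act on its entries without any fourth moment of \<open>x\<close>.

  \<^item> \<open>E |g|\<^sup>2 = O(T)\<close>, because the contributions of the windows are independent and centred.

Hence \<open>|b - \<beta>|\<^sup>2\<close> is of order \<open>1/T\<close>. By the Cauchy-Schwarz inequality the squared norm of every
block mean of \<open>x\<close> is at most \<open>1/w\<close> times the sum of all \<open>|x i|\<^sup>2\<close>, which is of order \<open>T/w\<close>. The square of
the second term is therefore of order \<open>1/w\<close>, uniformly over the blocks. Quantitatively,
Markov's inequality is applied to \<open>|g|\<^sup>2\<close> and to the sum of all \<open>|x i|\<^sup>2\<close> at the level \<open>K T\<close> with
\<open>K = w powr (1/4)\<close>. As \<open>K\<close> tends to infinity, both exceptional events become negligible, while the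
resulting bound \<open>K\<^sup>2 / (\<kappa>\<^sup>2 w)\<close> on the square still tends to zero.
\<close>

section \<open>The normal equations of the EM fixed point\<close>

text \<open>The quadratic form of \<open>within_scatter\<close>; see \<open>inner_within_scatter\<close>.\<close>

definition within_form :: "nat \<Rightarrow> nat \<Rightarrow> (nat \<Rightarrow> real ^ 'p) \<Rightarrow> real ^ 'p \<Rightarrow> real" where
  "within_form n0 T x v = (\<Sum>j=1..T. \<Sum>i\<in>window n0 j. (v \<bullet> (x i - window_mean n0 x j))\<^sup>2)"

definition within_score :: "nat \<Rightarrow> nat \<Rightarrow> (nat \<Rightarrow> real ^ 'p) \<Rightarrow> (nat \<Rightarrow> real) \<Rightarrow> real ^ 'p" where
  "within_score n0 T x e = (\<Sum>j=1..T. \<Sum>i\<in>window n0 j. e i *\<^sub>R (x i - window_mean n0 x j))"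

lemma finite_window [simp]: "finite (window n0 j)"
  by (simp add: window_def)

lemma card_window: "1 \<le> j \<Longrightarrow> card (window n0 j) = n0"
  by (cases j) (auto simp: window_def)

lemma window_subset: "j \<in> {1..T} \<Longrightarrow> window n0 j \<subseteq> {1..T * n0}"
proof
  fix i assume j: "j \<in> {1..T}" and i: "i \<in> window n0 j"
  have "j * n0 \<le> T * n0" using j by (intro mult_right_mono) auto
  then show "i \<in> {1..T * n0}" using i unfolding window_def atLeastAtMost_iff by linarith
qed

lemma window_disjoint:
  assumes "i \<in> window n0 j" "i \<in> window n0 l" "1 \<le> j" "1 \<le> l"
  shows "j = l"
proof -
  have "a \<le> b" if "i \<in> window n0 a" "i \<in> window n0 b" "1 \<le> a" for a b
  proof (rule ccontr)
    assume "\<not> a \<le> b"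
    then have "b * n0 \<le> (a - 1) * n0" by (intro mult_right_mono) auto
    then show False using that unfolding window_def atLeastAtMost_iff by linarith
  qed
  then show ?thesis using assms by (metis le_antisym)
qed

lemma sum_window_deviation:
  assumes "1 \<le> j" "1 \<le> n0"
  shows "(\<Sum>i\<in>window n0 j. x i - window_mean n0 x j) = 0"
  using assms by (simp add: sum_subtractf card_window window_mean_def sum_constant_scaleR
      del: sum_constant)

lemma inner_outer_prod_mult: "v \<bullet> (outer_prod u u *v v) = (v \<bullet> u)\<^sup>2"
proof -
  have "v \<bullet> (outer_prod u u *v v) = (\<Sum>a\<in>UNIV. \<Sum>b\<in>UNIV. (v $ a * u $ a) * (v $ b * u $ b))"
    by (simp add: inner_vec_def matrix_vector_mult_def outer_prod_def sum_distrib_left mult_ac)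
  also have "\<dots> = (v \<bullet> u)\<^sup>2"
    by (simp add: inner_vec_def power2_eq_square sum_product)
  finally show ?thesis .
qed

lemma sum_matrix_vector_mult:
  fixes A :: "'i \<Rightarrow> real ^ 'n ^ 'm"
  shows "(\<Sum>i\<in>I. A i) *v v = (\<Sum>i\<in>I. A i *v v)"
  by (induction I rule: infinite_finite_induct) (simp_all add: matrix_vector_mult_add_rdistrib)

lemma inner_within_scatter: "v \<bullet> (within_scatter n0 T x *v v) = within_form n0 T x v"
  by (simp add: within_scatter_def within_form_def sum_matrix_vector_mult inner_sum_right
      inner_outer_prod_mult)

lemma invertible_within_scatter:
  assumes "0 < \<kappa>" "\<And>v. \<kappa> * (norm v)\<^sup>2 \<le> within_form n0 T x v"
  shows "invertible (within_scatter n0 T x)"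
proof -
  have "v = 0" if "within_scatter n0 T x *v v = 0" for v
  proof -
    have "within_form n0 T x v = 0"
      using that inner_within_scatter[of v n0 T x] by simp
    then have "\<kappa> * (norm v)\<^sup>2 \<le> 0" using assms(2)[of v] by simp
    then have "(norm v)\<^sup>2 \<le> 0" using assms(1) by (simp add: mult_le_0_iff)
    then show ?thesis by simp
  qed
  then show ?thesis
    by (simp add: invertible_left_inverse matrix_left_invertible_ker)
qed

text \<open>Each window residual sums to zero. Pairing the second normal equation with \<open>\<theta> = b - \<beta>\<close>, one may
therefore centre the predictors in their windows, and then the window intercepts, both the true ones
\<open>\<mu> j\<close> and the fitted ones, drop out because the centred predictors sum to zero as well.\<close>

lemma EM_solution_form_eq_score:
  fixes x :: "nat \<Rightarrow> real ^ 'p"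
  assumes n0: "1 \<le> n0"
    and sol: "is_EM_solution n0 T x y b"
    and y: "\<And>i. i \<in> {1..T * n0} \<Longrightarrow> y i = x i \<bullet> \<beta> + m i + e i"
    and m: "\<And>j i. j \<in> {1..T} \<Longrightarrow> i \<in> window n0 j \<Longrightarrow> m i = \<mu> j"
  shows "within_form n0 T x (b - \<beta>) = (b - \<beta>) \<bullet> within_score n0 T x e"
proof -
  define \<theta> where "\<theta> = b - \<beta>"
  obtain a where a1: "\<And>j. j \<in> {1..T} \<Longrightarrow> (\<Sum>i\<in>window n0 j. y i - a j - x i \<bullet> b) = 0"
    and a2: "(\<Sum>j=1..T. \<Sum>i\<in>window n0 j. (y i - a j - x i \<bullet> b) *\<^sub>R x i) = 0"
    using sol unfolding is_EM_solution_def by blast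
  define r where "r j i = y i - a j - x i \<bullet> b" for j i
  define z where "z j i = x i - window_mean n0 x j" for j i
  have r: "r j i = e i - \<theta> \<bullet> z j i + (\<mu> j - a j - \<theta> \<bullet> window_mean n0 x j)"
    if "j \<in> {1..T}" "i \<in> window n0 j" for j i
  proof -
    have "i \<in> {1..T * n0}" using window_subset that by blast
    then show ?thesis
      using m[OF that] y unfolding r_def z_def \<theta>_def
      by (simp add: inner_diff_left inner_diff_right inner_commute)
  qed
  \<comment> \<open>The residual may be paired with \<open>x i\<close> or with the centred \<open>z j i\<close>, and its constant part \<open>C\<close> is lost.\<close>
  have per_window: "(\<Sum>i\<in>window n0 j. r j i * (\<theta> \<bullet> x i))
      = \<theta> \<bullet> (\<Sum>i\<in>window n0 j. e i *\<^sub>R z j i) - (\<Sum>i\<in>window n0 j. (\<theta> \<bullet> z j i)\<^sup>2)"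
    if j: "j \<in> {1..T}" for j
  proof -
    have r0: "(\<Sum>i\<in>window n0 j. r j i) = 0" using a1[OF j] by (simp add: r_def)
    have z0: "(\<Sum>i\<in>window n0 j. z j i) = 0"
      using sum_window_deviation[of j n0 x] j n0 by (simp add: z_def)
    define C where "C = \<mu> j - a j - \<theta> \<bullet> window_mean n0 x j"
    have "(\<Sum>i\<in>window n0 j. r j i * (\<theta> \<bullet> x i))
        = (\<Sum>i\<in>window n0 j. r j i * (\<theta> \<bullet> z j i) + r j i * (\<theta> \<bullet> window_mean n0 x j))"
      by (intro sum.cong refl) (simp add: z_def inner_diff_right algebra_simps)
    also have "\<dots> = (\<Sum>i\<in>window n0 j. r j i * (\<theta> \<bullet> z j i))"
      using r0 by (simp add: sum.distrib flip: sum_distrib_right)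
    also have "\<dots> = (\<Sum>i\<in>window n0 j. e i * (\<theta> \<bullet> z j i) - (\<theta> \<bullet> z j i)\<^sup>2 + C * (\<theta> \<bullet> z j i))"
      by (intro sum.cong refl) (simp add: r[OF j] C_def algebra_simps power2_eq_square)
    also have "\<dots> = (\<Sum>i\<in>window n0 j. e i * (\<theta> \<bullet> z j i)) - (\<Sum>i\<in>window n0 j. (\<theta> \<bullet> z j i)\<^sup>2)
        + C * (\<theta> \<bullet> (\<Sum>i\<in>window n0 j. z j i))"
      by (simp add: sum.distrib sum_subtractf inner_sum_right sum_distrib_left)
    finally show ?thesis using z0 by (simp add: inner_sum_right)
  qed
  have "0 = \<theta> \<bullet> (\<Sum>j=1..T. \<Sum>i\<in>window n0 j. r j i *\<^sub>R x i)"
    using a2 by (simp add: r_def)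
  also have "\<dots> = (\<Sum>j=1..T. \<Sum>i\<in>window n0 j. r j i * (\<theta> \<bullet> x i))"
    by (simp add: inner_sum_right)
  also have "\<dots> = \<theta> \<bullet> within_score n0 T x e - within_form n0 T x \<theta>"
    using per_window by (simp add: within_score_def within_form_def z_def inner_sum_right sum_subtractf)
  finally show ?thesis by (simp add: \<theta>_def)
qed

lemma EM_error_le_score:
  fixes x :: "nat \<Rightarrow> real ^ 'p"
  assumes "1 \<le> n0" "0 < \<kappa>" and form: "\<And>v. \<kappa> * (norm v)\<^sup>2 \<le> within_form n0 T x v"
    and "is_EM_solution n0 T x y b"
    and "\<And>i. i \<in> {1..T * n0} \<Longrightarrow> y i = x i \<bullet> \<beta> + m i + e i"
    and "\<And>j i. j \<in> {1..T} \<Longrightarrow> i \<in> window n0 j \<Longrightarrow> m i = \<mu> j"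
  shows "\<kappa> * norm (b - \<beta>) \<le> norm (within_score n0 T x e)"
proof (cases "b = \<beta>")
  case False
  have "\<kappa> * (norm (b - \<beta>))\<^sup>2 \<le> (b - \<beta>) \<bullet> within_score n0 T x e"
    using form[of "b - \<beta>"] EM_solution_form_eq_score[OF assms(1) assms(4-6)] by simp
  also have "\<dots> \<le> norm (b - \<beta>) * norm (within_score n0 T x e)"
    by (rule norm_cauchy_schwarz)
  finally have "norm (b - \<beta>) * (\<kappa> * norm (b - \<beta>)) \<le> norm (b - \<beta>) * norm (within_score n0 T x e)"
    by (simp add: power2_eq_square mult_ac)
  then show ?thesis using False by (simp add: mult_le_cancel_left_pos)
qed simp

section \<open>A lower bound for the within-window scatter\<close>

definition window_diff :: "nat \<Rightarrow> (nat \<Rightarrow> real ^ 'p) \<Rightarrow> nat \<Rightarrow> real ^ 'p" where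
  "window_diff n0 x j = x (1 + (j - 1) * n0) - x (2 + (j - 1) * n0)"

text \<open>A bounded multiple of \<open>d\<close> that vanishes in the same directions; it takes the place of truncation.\<close>

definition shrink :: "real ^ 'p \<Rightarrow> real ^ 'p" where
  "shrink d = (1 / sqrt (1 + (norm d)\<^sup>2)) *\<^sub>R d"

lemma first_two_in_window:
  assumes "2 \<le> n0" "1 \<le> j"
  shows "1 + (j - 1) * n0 \<in> window n0 j" "2 + (j - 1) * n0 \<in> window n0 j"
  using assms by (cases j; simp add: window_def)+

lemma norm_shrink_le: "norm (shrink d) \<le> 1"
proof -
  have "norm d \<le> sqrt (1 + (norm d)\<^sup>2)" by (rule real_le_rsqrt) simp
  moreover have "0 < sqrt (1 + (norm d)\<^sup>2)" by (simp add: add_pos_nonneg)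
  ultimately show ?thesis by (simp add: shrink_def)
qed

lemma inner_shrink_sq_le: "(v \<bullet> shrink d)\<^sup>2 \<le> (v \<bullet> d)\<^sup>2"
proof -
  have "(v \<bullet> shrink d)\<^sup>2 = (v \<bullet> d)\<^sup>2 / (1 + (norm d)\<^sup>2)"
    by (simp add: shrink_def power_mult_distrib power_divide add_nonneg_nonneg)
  also have "\<dots> \<le> (v \<bullet> d)\<^sup>2"
    by (simp add: pos_divide_le_eq add_pos_nonneg distrib_left)
  finally show ?thesis .
qed

text \<open>If \<open>p\<close> and \<open>q\<close> are the inner products of \<open>v\<close> with the first two centred predictors of a window, that window
contributes at least \<open>p\<^sup>2 + q\<^sup>2 \<ge> (p - q)\<^sup>2 / 2\<close>, and the window mean cancels in \<open>p - q\<close>. For i.i.d.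
predictors the lower bound is therefore a sum of i.i.d. terms.\<close>

lemma within_form_ge_differences:
  assumes "2 \<le> n0"
  shows "within_form n0 T x v \<ge> (1/2) * (\<Sum>j=1..T. (v \<bullet> shrink (window_diff n0 x j))\<^sup>2)"
proof -
  have "(1/2) * (v \<bullet> shrink (window_diff n0 x j))\<^sup>2
      \<le> (\<Sum>i\<in>window n0 j. (v \<bullet> (x i - window_mean n0 x j))\<^sup>2)" if j: "j \<in> {1..T}" for j
  proof -
    define f where "f i = v \<bullet> (x i - window_mean n0 x j)" for i
    define p q where "p = 1 + (j - 1) * n0" and "q = 2 + (j - 1) * n0"
    have "v \<bullet> window_diff n0 x j = f p - f q"
      by (simp add: window_diff_def f_def inner_diff_right p_def q_def)
    moreover have "(f p - f q)\<^sup>2 \<le> 2 * ((f p)\<^sup>2 + (f q)\<^sup>2)"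
      using zero_le_power2[of "f p + f q"] by (simp add: power2_eq_square algebra_simps)
    ultimately have "(1/2) * (v \<bullet> window_diff n0 x j)\<^sup>2 \<le> (f p)\<^sup>2 + (f q)\<^sup>2"
      by simp
    also have "\<dots> = (\<Sum>i\<in>{p, q}. (f i)\<^sup>2)" by (simp add: p_def q_def)
    also have "\<dots> \<le> (\<Sum>i\<in>window n0 j. (f i)\<^sup>2)"
      using first_two_in_window[OF assms, of j] j
      by (intro sum_mono2) (auto simp: p_def q_def)
    finally show ?thesis
      using inner_shrink_sq_le[of v "window_diff n0 x j"] by (simp add: f_def)
  qed
  then show ?thesis
    unfolding within_form_def sum_distrib_left by (intro sum_mono)
qed

lemma inner_sq_sum_eq:
  "(\<Sum>j\<in>J. (v \<bullet> h j)\<^sup>2) = (\<Sum>a\<in>UNIV. \<Sum>b\<in>UNIV. v $ a * v $ b * (\<Sum>j\<in>J. h j $ a * h j $ b))"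
proof -
  have "(\<Sum>j\<in>J. (v \<bullet> h j)\<^sup>2)
      = (\<Sum>j\<in>J. \<Sum>a\<in>UNIV. \<Sum>b\<in>UNIV. v $ a * v $ b * (h j $ a * h j $ b))"
    by (simp add: inner_vec_def power2_eq_square sum_product mult_ac)
  also have "\<dots> = (\<Sum>a\<in>UNIV. \<Sum>b\<in>UNIV. \<Sum>j\<in>J. v $ a * v $ b * (h j $ a * h j $ b))"
    by (subst sum.swap) (simp add: sum.swap[of _ J])
  finally show ?thesis by (simp add: sum_distrib_left)
qed

text \<open>Each of the entries contributes at most \<open>\<eta> * (norm v)\<^sup>2\<close> to the change of the form.\<close>

lemma quadratic_form_perturbation:
  fixes B A :: "'p::finite \<Rightarrow> 'p \<Rightarrow> real" and v :: "real ^ 'p"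
  assumes "\<And>a b. \<bar>B a b - A a b\<bar> \<le> \<eta>"
  shows "(\<Sum>a\<in>UNIV. \<Sum>b\<in>UNIV. v $ a * v $ b * B a b)
     \<ge> (\<Sum>a\<in>UNIV. \<Sum>b\<in>UNIV. v $ a * v $ b * A a b) - (real CARD('p))\<^sup>2 * \<eta> * (norm v)\<^sup>2"
proof -
  have "v $ a * v $ b * A a b - \<eta> * (norm v)\<^sup>2 \<le> v $ a * v $ b * B a b" for a b
  proof -
    have "\<bar>v $ a * v $ b * (A a b - B a b)\<bar> \<le> (norm v * norm v) * \<eta>"
      unfolding abs_mult
      using assms[of a b] by (intro mult_mono component_le_norm_cart) (auto simp: abs_minus_commute)
    then show ?thesis by (simp add: power2_eq_square algebra_simps abs_le_iff)
  qed
  then have "(\<Sum>a\<in>UNIV. \<Sum>b\<in>UNIV. v $ a * v $ b * A a b - \<eta> * (norm v)\<^sup>2)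
      \<le> (\<Sum>a\<in>UNIV. \<Sum>b\<in>UNIV. v $ a * v $ b * B a b)"
    by (intro sum_mono)
  then show ?thesis by (simp add: sum_subtractf power2_eq_square mult_ac)
qed

text \<open>The deviation allowed in each entry of the empirical moment matrix is chosen so that all
\<open>CARD('p)\<^sup>2\<close> entries together cost half of the lower bound \<open>\<kappa>\<close>; the remaining factor
\<open>1/2\<close> comes from \<open>within_form_ge_differences\<close>.\<close>

lemma within_form_ge_of_moments:
  fixes x :: "nat \<Rightarrow> real ^ 'p"
  assumes n0: "2 \<le> n0"
    and A: "\<And>v. \<kappa> * (norm v)\<^sup>2 \<le> (\<Sum>a\<in>UNIV. \<Sum>b\<in>UNIV. v $ a * v $ b * A a b)"
    and dev: "\<And>a b. \<bar>\<Sum>j=1..T. shrink (window_diff n0 x j) $ a * shrink (window_diff n0 x j) $ b - A a b\<bar>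
        \<le> T * (\<kappa> / (2 * (real CARD('p))\<^sup>2))"
  shows "(\<kappa> / 4) * T * (norm v)\<^sup>2 \<le> within_form n0 T x v"
proof -
  define h where "h j = shrink (window_diff n0 x j)" for j
  have "T * (\<kappa> * (norm v)\<^sup>2) - T * \<kappa> / 2 * (norm v)\<^sup>2
      \<le> T * (\<Sum>a\<in>UNIV. \<Sum>b\<in>UNIV. v $ a * v $ b * A a b) - T * \<kappa> / 2 * (norm v)\<^sup>2"
    using A[of v] by (intro diff_right_mono mult_left_mono) auto
  also have "\<dots> = (\<Sum>a\<in>UNIV. \<Sum>b\<in>UNIV. v $ a * v $ b * (T * A a b))
      - (real CARD('p))\<^sup>2 * (T * (\<kappa> / (2 * (real CARD('p))\<^sup>2))) * (norm v)\<^sup>2"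
    by (simp add: sum_distrib_left mult_ac)
  also have "\<dots> \<le> (\<Sum>a\<in>UNIV. \<Sum>b\<in>UNIV. v $ a * v $ b * (\<Sum>j=1..T. h j $ a * h j $ b))"
    using dev by (intro quadratic_form_perturbation) (simp add: h_def sum_subtractf)
  also have "\<dots> = (\<Sum>j=1..T. (v \<bullet> h j)\<^sup>2)"
    by (rule inner_sq_sum_eq[symmetric])
  finally show ?thesis
    using within_form_ge_differences[OF n0, where T = T and v = v and x = x] by (simp add: h_def)
qed

section \<open>Positive definiteness of the shrunken difference moments\<close>

lemma borel_measurable_shrink [measurable]: "shrink \<in> borel_measurable borel"
  unfolding shrink_def by measurable

lemma borel_measurable_nth [measurable (raw)]:
  fixes f :: "'a \<Rightarrow> real ^ 'p"
  shows "f \<in> borel_measurable M \<Longrightarrow> (\<lambda>x. f x $ a) \<in> borel_measurable M"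
  by (rule measurable_compose[OF _ borel_measurable_continuous_onI])
    (simp_all add: continuous_on_component)

text \<open>The second moment matrix of \<open>shrink (x - x')\<close> for independent \<open>x\<close> and \<open>x'\<close> with law \<open>F\<close>.\<close>

definition shrunk_diff_moment :: "(real ^ 'p) measure \<Rightarrow> 'p \<Rightarrow> 'p \<Rightarrow> real" where
  "shrunk_diff_moment F a b =
     (\<integral>p. shrink (fst p - snd p) $ a * shrink (fst p - snd p) $ b \<partial>(F \<Otimes>\<^sub>M F))"

lemma abs_shrink_prod_le: "\<bar>shrink d $ a * shrink d $ b\<bar> \<le> 1"
proof -
  have "\<bar>shrink d $ c\<bar> \<le> 1" for c
    using component_le_norm_cart[of "shrink d" c] norm_shrink_le[of d] by linarith
  then have "\<bar>shrink d $ a\<bar> * \<bar>shrink d $ b\<bar> \<le> 1 * 1"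
    by (intro mult_mono) auto
  then show ?thesis by (simp add: abs_mult)
qed

lemma integrable_component:
  fixes F :: "(real ^ 'p) measure"
  assumes "finite_measure F" and sets: "sets F = sets borel"
    and sq: "integrable F (\<lambda>v. (norm v)\<^sup>2)"
  shows "integrable F (\<lambda>v. v $ a)"
proof -
  interpret finite_measure F by fact
  note [measurable_cong] = sets
  have "integrable F (\<lambda>v. (v $ a)\<^sup>2)"
    by (rule Bochner_Integration.integrable_bound[OF sq])
      (auto simp: component_le_norm_cart simp flip: abs_le_square_iff)
  then show ?thesis
    by (rule square_integrable_imp_integrable[rotated]) measurable
qed

lemma quadratic_form_covariance_matrix:
  fixes F :: "(real ^ 'p) measure"
  assumes "prob_space F" and sets: "sets F = sets borel"
    and sq: "integrable F (\<lambda>v. (norm v)\<^sup>2)"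
  shows "v \<bullet> (covariance_matrix F *v v) = (\<integral>u. (v \<bullet> (u - (\<chi> a. \<integral>u. u $ a \<partial>F)))\<^sup>2 \<partial>F)"
proof -
  interpret prob_space F by fact
  note [measurable_cong] = sets
  define m :: "real ^ 'p" where "m = (\<chi> a. \<integral>u. u $ a \<partial>F)"
  have lin: "integrable F (\<lambda>u. u $ a)" for a
    using integrable_component[OF finite_measure_axioms sets sq] .
  have quad: "integrable F (\<lambda>u. u $ a * u $ b)" for a b
    by (rule Bochner_Integration.integrable_bound[OF sq])
      (auto simp: abs_mult power2_eq_square intro!: mult_mono component_le_norm_cart)
  have int: "integrable F (\<lambda>u. (u $ a - m $ a) * (u $ b - m $ b))" for a b
    unfolding left_diff_distrib right_diff_distrib
    by (intro Bochner_Integration.integrable_diff quad integrable_mult_left integrable_mult_right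
        lin integrable_const)
  have "v \<bullet> (covariance_matrix F *v v)
      = (\<Sum>a\<in>UNIV. \<Sum>b\<in>UNIV. v $ a * v $ b * (\<integral>u. (u $ a - m $ a) * (u $ b - m $ b) \<partial>F))"
    by (simp add: inner_vec_def matrix_vector_mult_def covariance_matrix_def m_def
        sum_distrib_left mult_ac)
  also have "\<dots> = (\<Sum>a\<in>UNIV. \<Sum>b\<in>UNIV. \<integral>u. v $ a * v $ b * ((u $ a - m $ a) * (u $ b - m $ b)) \<partial>F)"
    by simp
  also have "\<dots> = (\<integral>u. (\<Sum>a\<in>UNIV. \<Sum>b\<in>UNIV. v $ a * v $ b * ((u $ a - m $ a) * (u $ b - m $ b))) \<partial>F)"
    by (subst Bochner_Integration.integral_sum, intro Bochner_Integration.integrable_sum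
        integrable_mult_right int) (intro sum.cong refl Bochner_Integration.integral_sum[symmetric]
        integrable_mult_right int)
  also have "\<dots> = (\<integral>u. (v \<bullet> (u - m))\<^sup>2 \<partial>F)"
  proof -
    have "(\<Sum>a\<in>UNIV. \<Sum>b\<in>UNIV. v $ a * v $ b * (d $ a * d $ b)) = (v \<bullet> d)\<^sup>2" for d
      by (simp add: inner_vec_def power2_eq_square sum_product mult_ac)
    from this[of "_ - m"] show ?thesis by simp
  qed
  finally show ?thesis by (simp add: m_def)
qed

text \<open>If the form vanishes at \<open>v \<noteq> 0\<close>, then \<open>v \<bullet> x = v \<bullet> x'\<close> almost surely for independent copies, so
\<open>v \<bullet> x\<close> is almost surely constant and has variance zero, against positive definiteness of the
covariance matrix. Compactness of the unit sphere turns strict positivity into the constant \<open>\<kappa>\<close>.\<close>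

lemma shrunk_diff_moment_positive_definite:
  fixes F :: "(real ^ 'p) measure"
  assumes F: "prob_space F" and sets: "sets F = sets borel"
    and sq: "integrable F (\<lambda>v. (norm v)\<^sup>2)"
    and pd: "positive_definite (covariance_matrix F)"
  shows "\<exists>\<kappa>>0. \<forall>v. \<kappa> * (norm v)\<^sup>2 \<le> (\<Sum>a\<in>UNIV. \<Sum>b\<in>UNIV. v $ a * v $ b * shrunk_diff_moment F a b)"
proof -
  interpret F: prob_space F by fact
  interpret FF: pair_prob_space F F ..
  note [measurable_cong] = sets
  define q where "q v = (\<Sum>a\<in>UNIV. \<Sum>b\<in>UNIV. v $ a * v $ b * shrunk_diff_moment F a b)" for v :: "real ^ 'p"
  have int: "integrable (F \<Otimes>\<^sub>M F) (\<lambda>p. shrink (fst p - snd p) $ a * shrink (fst p - snd p) $ b)" for a b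
    by (rule FF.integrable_const_bound[where B = 1]) (auto simp: abs_shrink_prod_le)
  have q_eq: "q v = (\<integral>p. (v \<bullet> shrink (fst p - snd p))\<^sup>2 \<partial>(F \<Otimes>\<^sub>M F))"
    and q_int: "integrable (F \<Otimes>\<^sub>M F) (\<lambda>p. (v \<bullet> shrink (fst p - snd p))\<^sup>2)" for v
  proof -
    have expand: "(v \<bullet> d)\<^sup>2 = (\<Sum>a\<in>UNIV. \<Sum>b\<in>UNIV. v $ a * v $ b * (d $ a * d $ b))" for d
      by (simp add: inner_vec_def power2_eq_square sum_product mult_ac)
    show "integrable (F \<Otimes>\<^sub>M F) (\<lambda>p. (v \<bullet> shrink (fst p - snd p))\<^sup>2)"
      unfolding expand using int by (intro Bochner_Integration.integrable_sum integrable_mult_right)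
    show "q v = (\<integral>p. (v \<bullet> shrink (fst p - snd p))\<^sup>2 \<partial>(F \<Otimes>\<^sub>M F))"
      unfolding expand q_def using int
      by (simp add: Bochner_Integration.integral_sum shrunk_diff_moment_def)
  qed
  have q_pos: "0 < q v" if "v \<noteq> 0" for v
  proof (rule ccontr)
    assume "\<not> 0 < q v"
    moreover have "0 \<le> q v" unfolding q_eq by (rule integral_nonneg_AE) simp
    ultimately have "(\<integral>p. (v \<bullet> shrink (fst p - snd p))\<^sup>2 \<partial>(F \<Otimes>\<^sub>M F)) = 0"
      using q_eq[of v] by linarith
    then have "AE p in F \<Otimes>\<^sub>M F. (v \<bullet> shrink (fst p - snd p))\<^sup>2 = 0"
      using q_int by (subst (asm) integral_nonneg_eq_0_iff_AE) auto
    moreover have "v \<bullet> fst p = v \<bullet> snd p" if "(v \<bullet> shrink (fst p - snd p))\<^sup>2 = 0" for p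
    proof -
      have "sqrt (1 + (norm (fst p - snd p))\<^sup>2) \<noteq> 0"
        by (simp add: add_nonneg_eq_0_iff)
      then show ?thesis using that by (simp add: shrink_def inner_diff_right)
    qed
    ultimately have "AE p in F \<Otimes>\<^sub>M F. v \<bullet> fst p = v \<bullet> snd p"
      by (rule eventually_mono)
    then have "AE u in F. AE u' in F. v \<bullet> u = v \<bullet> u'"
      using FF.AE_pair[of "\<lambda>p. v \<bullet> fst p = v \<bullet> snd p"] by simp
    then have "\<not> (AE u in F. \<not> (AE u' in F. v \<bullet> u = v \<bullet> u'))"
      using F.AE_contr by blast
    then obtain u where u: "AE u' in F. v \<bullet> u = v \<bullet> u'"
      by (meson AE_I2)
    define m :: "real ^ 'p" where "m = (\<chi> a. \<integral>u. u $ a \<partial>F)"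
    have comp: "integrable F (\<lambda>u. u $ a)" for a
      using integrable_component[OF F.finite_measure_axioms sets sq] .
    have "v \<bullet> m = (\<integral>u'. v \<bullet> u' \<partial>F)"
      using comp by (simp add: m_def inner_vec_def Bochner_Integration.integral_sum)
    also have "\<dots> = (\<integral>u'. v \<bullet> u \<partial>F)"
      by (intro integral_cong_AE) (use u in \<open>auto elim: eventually_mono\<close>)
    finally have "v \<bullet> m = v \<bullet> u" using F.prob_space by simp
    then have "(v \<bullet> (u' - m))\<^sup>2 = 0" if "v \<bullet> u = v \<bullet> u'" for u'
      using that by (simp add: inner_diff_right)
    then have "AE u' in F. (v \<bullet> (u' - m))\<^sup>2 = 0"
      by (rule eventually_mono[OF u])
    then have "v \<bullet> (covariance_matrix F *v v) = 0"
      unfolding quadratic_form_covariance_matrix[OF F sets sq] m_def[symmetric]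
      by (intro integral_eq_zero_AE) auto
    then show False using pd \<open>v \<noteq> 0\<close> unfolding positive_definite_def by (metis less_irrefl)
  qed
  have "axis undefined 1 \<in> sphere (0 :: real ^ 'p) 1" by simp
  then have "sphere (0 :: real ^ 'p) 1 \<noteq> {}" by blast
  moreover have "continuous_on (sphere 0 1) q"
    unfolding q_def by (intro continuous_intros)
  ultimately obtain v0 where v0: "v0 \<in> sphere 0 1" "\<And>v. v \<in> sphere 0 1 \<Longrightarrow> q v0 \<le> q v"
    using continuous_attains_inf[OF compact_sphere, of 0 1 q] by blast
  have "q v0 * (norm v)\<^sup>2 \<le> q v" for v
  proof (cases "v = 0")
    case False
    define u where "u = (1 / norm v) *\<^sub>R v"
    have "u \<in> sphere 0 1" using False by (simp add: u_def)
    then have "q v0 \<le> q u" by (rule v0(2))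
    also have "q u * (norm v)\<^sup>2 = q v"
      using False by (simp add: u_def q_def sum_distrib_left sum_distrib_right power2_eq_square)
    then have "q u = q v / (norm v)\<^sup>2" using False by (simp add: field_simps)
    finally show ?thesis using False by (simp add: pos_le_divide_eq)
  qed (simp add: q_def)
  moreover have "0 < q v0" using v0(1) by (intro q_pos) auto
  ultimately show ?thesis unfolding q_def by blast
qed

section \<open>Block intercepts\<close>

text \<open>This and its counterpart for \<open>Min\<close> reduce the extremes over blocks to uniform closeness.\<close>

lemma abs_Max_diff_le:
  fixes f g :: "'i \<Rightarrow> real"
  assumes "finite I" "I \<noteq> {}" "\<And>i. i \<in> I \<Longrightarrow> \<bar>f i - g i\<bar> \<le> d"
  shows "\<bar>Max (f ` I) - Max (g ` I)\<bar> \<le> d"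
proof -
  have "Max (f ` I) \<le> Max (g ` I) + d" if "\<And>i. i \<in> I \<Longrightarrow> \<bar>f i - g i\<bar> \<le> d" for f g
  proof (rule Max.boundedI)
    fix a assume "a \<in> f ` I"
    then obtain i where "i \<in> I" "a = f i" by blast
    moreover from this have "g i \<le> Max (g ` I)" using assms by (intro Max_ge) auto
    ultimately show "a \<le> Max (g ` I) + d" using that[of i] by (simp add: abs_le_iff)
  qed (use assms in auto)
  from this[of f g] this[of g f] assms(3) show ?thesis
    by (simp add: abs_le_iff abs_minus_commute algebra_simps)
qed

lemma abs_Min_diff_le:
  fixes f g :: "'i \<Rightarrow> real"
  assumes "finite I" "I \<noteq> {}" "\<And>i. i \<in> I \<Longrightarrow> \<bar>f i - g i\<bar> \<le> d"
  shows "\<bar>Min (f ` I) - Min (g ` I)\<bar> \<le> d"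
proof -
  have "Min (g ` I) - d \<le> Min (f ` I)" if "\<And>i. i \<in> I \<Longrightarrow> \<bar>f i - g i\<bar> \<le> d" for f g
  proof (rule Min.boundedI)
    fix a assume "a \<in> f ` I"
    then obtain i where "i \<in> I" "a = f i" by blast
    moreover from this have "Min (g ` I) \<le> g i" using assms by (intro Min_le) auto
    ultimately show "Min (g ` I) - d \<le> a" using that[of i] by (simp add: abs_le_iff)
  qed (use assms in auto)
  from this[of f g] this[of g f] assms(3) show ?thesis
    by (simp add: abs_le_iff abs_minus_commute algebra_simps)
qed

lemma norm_sum_sq_le: "(norm (\<Sum>i\<in>A. x i))\<^sup>2 \<le> real (card A) * (\<Sum>i\<in>A. (norm (x i))\<^sup>2)"
proof -
  have "(norm (\<Sum>i\<in>A. x i))\<^sup>2 \<le> (\<Sum>i\<in>A. norm (x i) * 1)\<^sup>2"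
    by (intro power_mono) (auto intro: norm_sum)
  also have "\<dots> \<le> (\<Sum>i\<in>A. (norm (x i))\<^sup>2) * (\<Sum>i\<in>A. 1\<^sup>2)"
    by (rule Cauchy_Schwarz_ineq_sum)
  finally show ?thesis by (simp add: mult.commute)
qed

text \<open>Deterministic core of the argument: on the event described by the hypotheses, the noise mean and
the effect of the estimation error contribute at most \<open>\<delta> / 2\<close> each. The sum of the squared norms of the predictors
over a block is bounded by the sum over all observations. This crude step is harmless: it loses a factor
\<open>n / w\<close>, which the squared estimation error of order \<open>1 / n\<close> reduces to \<open>1 / w\<close>.\<close>

lemma block_intercept_error_le:
  fixes x :: "nat \<Rightarrow> real ^ 'p"
  assumes w: "1 \<le> w" "w \<le> n" and l: "l \<in> {1..n - w + 1}" and "0 < \<kappa>" "0 < T" "0 \<le> \<delta>"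
    and y: "\<And>i. i \<in> {1..n} \<Longrightarrow> y i = x i \<bullet> \<beta> + m i + e i"
    and e: "\<bar>\<Sum>i=l..l+w-1. e i\<bar> \<le> real w * (\<delta> / 2)"
    and x: "(\<Sum>i=1..n. (norm (x i))\<^sup>2) \<le> K * T"
    and g: "\<kappa> * T * norm (b - \<beta>) \<le> norm g" "(norm g)\<^sup>2 \<le> K * T"
    and K: "0 \<le> K" "K\<^sup>2 / (\<kappa>\<^sup>2 * real w) \<le> (\<delta> / 2)\<^sup>2"
  shows "\<bar>block_intercept w x y b l - (1 / real w) * (\<Sum>i=l..l+w-1. m i)\<bar> \<le> \<delta>"
proof -
  let ?B = "{l..l+w-1}"
  define \<theta> where "\<theta> = b - \<beta>"
  have B: "?B \<subseteq> {1..n}" "card ?B = w" using w l by auto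
  have eq: "block_intercept w x y b l - (1 / real w) * (\<Sum>i\<in>?B. m i)
      = (\<Sum>i\<in>?B. e i) / real w - ((\<Sum>i\<in>?B. x i) \<bullet> \<theta>) / real w"
  proof -
    have "(\<Sum>i\<in>?B. y i - x i \<bullet> b) = (\<Sum>i\<in>?B. m i + e i - x i \<bullet> \<theta>)"
      using y B(1) by (intro sum.cong refl) (auto simp: \<theta>_def inner_diff_right subset_iff)
    then show ?thesis
      using w block_intercept_eq[of w x y b l]
      by (simp add: sum.distrib sum_subtractf inner_sum_left add_divide_distrib diff_divide_distrib)
  qed
  have "((\<Sum>i\<in>?B. x i) \<bullet> \<theta>)\<^sup>2 \<le> (norm (\<Sum>i\<in>?B. x i))\<^sup>2 * (norm \<theta>)\<^sup>2"
    by (simp add: Cauchy_Schwarz_ineq power2_norm_eq_inner)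
  also have "\<dots> \<le> (real w * (K * T)) * ((K * T) / (\<kappa> * T)\<^sup>2)"
  proof (rule mult_mono)
    have "(\<Sum>i\<in>?B. (norm (x i))\<^sup>2) \<le> (\<Sum>i=1..n. (norm (x i))\<^sup>2)"
      using B(1) by (intro sum_mono2) auto
    then have "real w * (\<Sum>i\<in>?B. (norm (x i))\<^sup>2) \<le> real w * (K * T)"
      using x by (intro mult_left_mono) auto
    then show "(norm (\<Sum>i\<in>?B. x i))\<^sup>2 \<le> real w * (K * T)"
      using norm_sum_sq_le[of x ?B] B(2) by simp
    have "(\<kappa> * T * norm \<theta>)\<^sup>2 \<le> (norm g)\<^sup>2"
      using g(1) assms(4,5) by (intro power_mono) (auto simp: \<theta>_def)
    then have "(norm \<theta>)\<^sup>2 * (\<kappa> * T)\<^sup>2 \<le> K * T"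
      using g(2) by (simp add: power_mult_distrib mult_ac)
    then show "(norm \<theta>)\<^sup>2 \<le> (K * T) / (\<kappa> * T)\<^sup>2"
      using assms(4,5) by (simp add: pos_le_divide_eq)
  qed (use assms in auto)
  also have "\<dots> = (real w)\<^sup>2 * (K\<^sup>2 / (\<kappa>\<^sup>2 * real w))"
    using w assms(4,5) by (simp add: power2_eq_square field_simps)
  also have "\<dots> \<le> (real w)\<^sup>2 * (\<delta> / 2)\<^sup>2"
    using K(2) by (rule mult_left_mono) simp
  finally have "((\<Sum>i\<in>?B. x i) \<bullet> \<theta>)\<^sup>2 \<le> (real w * (\<delta> / 2))\<^sup>2"
    by (simp only: power_mult_distrib)
  then have "\<bar>(\<Sum>i\<in>?B. x i) \<bullet> \<theta>\<bar> \<le> \<bar>real w * (\<delta> / 2)\<bar>"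
    by (simp only: abs_le_square_iff)
  also have "\<dots> = real w * (\<delta> / 2)"
    using assms(6) by simp
  finally have "\<bar>(\<Sum>i\<in>?B. x i) \<bullet> \<theta>\<bar> \<le> real w * (\<delta> / 2)" .
  then have 1: "\<bar>((\<Sum>i\<in>?B. x i) \<bullet> \<theta>) / real w\<bar> \<le> \<delta> / 2"
    using w by (simp add: pos_divide_le_eq mult.commute)
  have 2: "\<bar>(\<Sum>i\<in>?B. e i) / real w\<bar> \<le> \<delta> / 2"
    using e w by (simp add: pos_divide_le_eq mult.commute)
  show ?thesis unfolding eq using 1 2 by linarith
qed

section \<open>Gaussian tails and sums of independent variables\<close>

text \<open>Completing the square: exponential tilting of a centred normal density shifts its mean.\<close>

lemma normal_density_times_exp:
  assumes "0 < s"
  shows "normal_density 0 s u * exp (t * u) = exp (t\<^sup>2 * s\<^sup>2 / 2) * normal_density (t * s\<^sup>2) s u"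
proof -
  have "- u\<^sup>2 / (2 * s\<^sup>2) + t * u = t\<^sup>2 * s\<^sup>2 / 2 + - (u - t * s\<^sup>2)\<^sup>2 / (2 * s\<^sup>2)"
    using assms by (simp add: field_simps power2_eq_square)
  then have "exp (- u\<^sup>2 / (2 * s\<^sup>2)) * exp (t * u) = exp (t\<^sup>2 * s\<^sup>2 / 2) * exp (- (u - t * s\<^sup>2)\<^sup>2 / (2 * s\<^sup>2))"
    by (simp only: exp_add[symmetric])
  then show ?thesis
    by (simp add: normal_density_def)
qed

context prob_space
begin

lemma normal_exp_moment:
  assumes "distributed M lborel X (normal_density 0 s)" "0 < s"
  shows "integrable M (\<lambda>\<omega>. exp (t * X \<omega>))" "expectation (\<lambda>\<omega>. exp (t * X \<omega>)) = exp (t\<^sup>2 * s\<^sup>2 / 2)"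
proof -
  have "integrable lborel (\<lambda>u. normal_density 0 s u * exp (t * u))"
    using assms(2) by (simp add: normal_density_times_exp)
  then show "integrable M (\<lambda>\<omega>. exp (t * X \<omega>))"
    by (subst (asm) distributed_integrable[OF assms(1)]) auto
  have "expectation (\<lambda>\<omega>. exp (t * X \<omega>)) = (\<integral>u. normal_density 0 s u * exp (t * u) \<partial>lborel)"
    by (rule distributed_integral[OF assms(1), symmetric]) auto
  also have "\<dots> = exp (t\<^sup>2 * s\<^sup>2 / 2)"
    using assms(2) by (simp add: normal_density_times_exp)
  finally show "expectation (\<lambda>\<omega>. exp (t * X \<omega>)) = exp (t\<^sup>2 * s\<^sup>2 / 2)" .
qed

lemma normal_upper_tail:
  assumes X: "distributed M lborel X (normal_density 0 s)" "0 < s" and V: "s\<^sup>2 \<le> V" and a: "0 \<le> a"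
  shows "prob {\<omega> \<in> space M. a \<le> X \<omega>} \<le> exp (- a\<^sup>2 / (2 * V))"
proof -
  have [measurable]: "X \<in> borel_measurable M"
    using distributed_measurable[OF X(1)] by simp
  have V0: "0 < V" using V X(2) by (meson less_le_trans zero_less_power)
  \<comment> \<open>The minimiser of the Chernoff exponent \<open>t\<^sup>2 * V / 2 - t * a\<close>.\<close>
  define t where "t = a / V"
  have t: "0 \<le> t" using a V0 by (simp add: t_def)
  have "prob {\<omega> \<in> space M. a \<le> X \<omega>} \<le> prob {\<omega> \<in> space M. exp (t * a) \<le> exp (t * X \<omega>)}"
    using t by (intro finite_measure_mono) (auto intro: mult_left_mono)
  also have "\<dots> \<le> expectation (\<lambda>\<omega>. exp (t * X \<omega>)) / exp (t * a)"
    by (rule integral_Markov_inequality_measure[where A = "{}"])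
      (auto simp: normal_exp_moment[OF X])
  also have "\<dots> = exp (t\<^sup>2 * s\<^sup>2 / 2 - t * a)"
    by (simp add: normal_exp_moment[OF X] exp_diff)
  also have "\<dots> \<le> exp (t\<^sup>2 * V / 2 - t * a)"
    using V by (auto intro: mult_left_mono)
  also have "t\<^sup>2 * V / 2 - t * a = - a\<^sup>2 / (2 * V)"
    using V0 by (simp add: t_def field_simps power2_eq_square)
  finally show ?thesis .
qed

lemma normal_tail:
  assumes X: "distributed M lborel X (normal_density 0 s)" "0 < s" and V: "s\<^sup>2 \<le> V" and a: "0 \<le> a"
  shows "prob {\<omega> \<in> space M. a \<le> \<bar>X \<omega>\<bar>} \<le> 2 * exp (- a\<^sup>2 / (2 * V))"
proof -
  have [measurable]: "X \<in> borel_measurable M"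
    using distributed_measurable[OF X(1)] by simp
  have minus: "distributed M lborel (\<lambda>\<omega>. - X \<omega>) (normal_density 0 s)"
    using normal_density_affine[OF X, of "-1" 0] by simp
  have "prob {\<omega> \<in> space M. a \<le> \<bar>X \<omega>\<bar>}
      \<le> prob ({\<omega> \<in> space M. a \<le> X \<omega>} \<union> {\<omega> \<in> space M. a \<le> - X \<omega>})"
    by (intro finite_measure_mono) auto
  also have "\<dots> \<le> prob {\<omega> \<in> space M. a \<le> X \<omega>} + prob {\<omega> \<in> space M. a \<le> - X \<omega>}"
    by (intro measure_Un_le) auto
  also have "\<dots> \<le> 2 * exp (- a\<^sup>2 / (2 * V))"
    using normal_upper_tail[OF X V a] normal_upper_tail[OF minus X(2) V a] by simp
  finally show ?thesis .
qed

lemma indep_vars_imp_indep_var: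
  assumes "indep_vars N X I" "i \<in> I" "l \<in> I" "i \<noteq> l"
  shows "indep_var (N i) (X i) (N l) (X l)"
proof -
  have "indep_var (N i) ((\<lambda>f. f i) \<circ> (\<lambda>\<omega>. restrict (\<lambda>i. X i \<omega>) {i}))
      (N l) ((\<lambda>f. f l) \<circ> (\<lambda>\<omega>. restrict (\<lambda>i. X i \<omega>) {l}))"
    using assms by (intro indep_var_compose[OF indep_var_restrict[OF assms(1)]]) auto
  then show ?thesis by (simp add: comp_def)
qed

lemma second_moment_indep_sum:
  fixes Y :: "'i \<Rightarrow> 'a \<Rightarrow> real"
  assumes J: "finite J" and indep: "indep_vars (\<lambda>_. borel) Y J"
    and sq: "\<And>j. j \<in> J \<Longrightarrow> integrable M (\<lambda>\<omega>. (Y j \<omega>)\<^sup>2)"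
    and centred: "\<And>j. j \<in> J \<Longrightarrow> expectation (Y j) = 0"
  shows "integrable M (\<lambda>\<omega>. (\<Sum>j\<in>J. Y j \<omega>)\<^sup>2)"
    and "expectation (\<lambda>\<omega>. (\<Sum>j\<in>J. Y j \<omega>)\<^sup>2) = (\<Sum>j\<in>J. expectation (\<lambda>\<omega>. (Y j \<omega>)\<^sup>2))"
proof -
  have meas: "Y j \<in> borel_measurable M" if "j \<in> J" for j
    using indep that by (auto simp: indep_vars_def)
  have int: "integrable M (Y j)" if "j \<in> J" for j
    using square_integrable_imp_integrable[OF meas sq] that by blast
  have prod: "integrable M (\<lambda>\<omega>. Y i \<omega> * Y j \<omega>) \<and>
      expectation (\<lambda>\<omega>. Y i \<omega> * Y j \<omega>) = (if i = j then expectation (\<lambda>\<omega>. (Y j \<omega>)\<^sup>2) else 0)"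
    if "i \<in> J" "j \<in> J" for i j
  proof (cases "i = j")
    case True
    then show ?thesis using sq[OF that(2)] by (simp add: power2_eq_square)
  next
    case False
    have ind: "indep_var borel (Y i) borel (Y j)"
      using indep_vars_imp_indep_var[OF indep that False] .
    show ?thesis
      using indep_var_integrable[OF ind int int] indep_var_lebesgue_integral[OF ind int int]
        that False centred by simp
  qed
  have expand: "(\<Sum>j\<in>J. Y j \<omega>)\<^sup>2 = (\<Sum>i\<in>J. \<Sum>j\<in>J. Y i \<omega> * Y j \<omega>)" for \<omega>
    by (simp add: power2_eq_square sum_product)
  show "integrable M (\<lambda>\<omega>. (\<Sum>j\<in>J. Y j \<omega>)\<^sup>2)"
    unfolding expand using prod by (intro Bochner_Integration.integrable_sum) auto
  have "expectation (\<lambda>\<omega>. (\<Sum>j\<in>J. Y j \<omega>)\<^sup>2) = (\<Sum>i\<in>J. \<Sum>j\<in>J. expectation (\<lambda>\<omega>. Y i \<omega> * Y j \<omega>))"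
    unfolding expand using prod by (simp add: Bochner_Integration.integral_sum)
  also have "\<dots> = (\<Sum>i\<in>J. \<Sum>j\<in>J. if i = j then expectation (\<lambda>\<omega>. (Y j \<omega>)\<^sup>2) else 0)"
    using prod by (intro sum.cong refl) blast
  also have "\<dots> = (\<Sum>j\<in>J. expectation (\<lambda>\<omega>. (Y j \<omega>)\<^sup>2))"
    using J by simp
  finally show "expectation (\<lambda>\<omega>. (\<Sum>j\<in>J. Y j \<omega>)\<^sup>2) = (\<Sum>j\<in>J. expectation (\<lambda>\<omega>. (Y j \<omega>)\<^sup>2))" .
qed

lemma prob_ge_le_expectation:
  assumes "integrable M f" "\<And>\<omega>. \<omega> \<in> space M \<Longrightarrow> 0 \<le> f \<omega>" "expectation f \<le> m" "0 < c"
  shows "prob {\<omega> \<in> space M. c \<le> f \<omega>} \<le> m / c"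
proof -
  have "prob {\<omega> \<in> space M. c \<le> f \<omega>} \<le> expectation f / c"
    using assms by (intro integral_Markov_inequality_measure[where A = "{}"]) auto
  then show ?thesis
    using assms divide_right_mono[of "expectation f" m c] by simp
qed

end

section \<open>Probability bounds for a fixed number of windows\<close>

text \<open>The setting of \<open>k_sample_regression\<close> in which the noise is a function of the observation and hence
independent over \<open>i\<close>. The samples matter only through the standard deviations \<open>s i\<close>, bounded by \<open>S\<close>.
Independence of \<open>x i\<close> and \<open>e i\<close> is expressed through real functions of \<open>x i\<close> because
\<open>indep_var\<close> relates variables with a common value type.\<close>

locale window_regression = prob_space M
  for M :: "'a measure" +
  fixes n0 T :: nat and F :: "(real ^ 'p) measure"
    and x :: "nat \<Rightarrow> 'a \<Rightarrow> real ^ 'p" and e :: "nat \<Rightarrow> 'a \<Rightarrow> real"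
    and s :: "nat \<Rightarrow> real" and S :: real
  assumes n0: "2 \<le> n0" and T: "1 \<le> T"
    and indep: "indep_vars (\<lambda>_. borel) (\<lambda>i \<omega>. (x i \<omega>, e i \<omega>)) {1..T * n0}"
    and indep_same: "\<And>i \<phi>. i \<in> {1..T * n0} \<Longrightarrow> \<phi> \<in> borel_measurable borel \<Longrightarrow>
      indep_var borel (\<lambda>\<omega>. \<phi> (x i \<omega>) :: real) borel (e i)"
    and x_distr: "\<And>i. i \<in> {1..T * n0} \<Longrightarrow> distr M borel (x i) = F"
    and e_normal: "\<And>i. i \<in> {1..T * n0} \<Longrightarrow> distributed M lborel (e i) (normal_density 0 (s i))"
    and s: "\<And>i. i \<in> {1..T * n0} \<Longrightarrow> 0 < s i \<and> s i \<le> S"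
    and second_moment: "integrable F (\<lambda>v. (norm v)\<^sup>2)"
begin

abbreviation "I \<equiv> {1..T * n0}"

definition mean_sq :: real where "mean_sq = (\<integral>v. (norm v)\<^sup>2 \<partial>F)"

lemma fst_measurable: "(fst :: (real ^ 'p) \<times> real \<Rightarrow> _) \<in> borel_measurable borel"
  and snd_measurable: "(snd :: (real ^ 'p) \<times> real \<Rightarrow> _) \<in> borel_measurable borel"
  by (auto intro!: borel_measurable_continuous_onI continuous_intros)

lemma pair_measurable: "i \<in> I \<Longrightarrow> (\<lambda>\<omega>. (x i \<omega>, e i \<omega>)) \<in> borel_measurable M"
  using indep by (simp add: indep_vars_def)

lemma x_measurable: "i \<in> I \<Longrightarrow> x i \<in> borel_measurable M"
  using measurable_compose[OF pair_measurable fst_measurable] by simp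

lemma e_measurable: "i \<in> I \<Longrightarrow> e i \<in> borel_measurable M"
  using measurable_compose[OF pair_measurable snd_measurable] by simp

lemma sets_F: "sets F = sets borel"
proof -
  have "1 \<in> I" using n0 T by (cases T) auto
  then show ?thesis using x_distr by (metis sets_distr)
qed

lemma S_pos: "0 < S"
proof -
  have "1 \<in> I" using n0 T by (cases T) auto
  then show ?thesis using s[of 1] by linarith
qed

lemma prob_space_F: "prob_space F"
proof -
  have "1 \<in> I" using n0 T by (cases T) auto
  then show ?thesis using x_distr x_measurable prob_space_distr by metis
qed

lemma indep_x_e:
  assumes "i \<in> I" "l \<in> I" and \<phi>: "\<phi> \<in> borel_measurable borel"
  shows "indep_var borel (\<lambda>\<omega>. \<phi> (x i \<omega>) :: real) borel (e l)"
proof (cases "i = l")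
  case False
  have "indep_var borel ((\<lambda>p. \<phi> (fst p)) \<circ> (\<lambda>\<omega>. (x i \<omega>, e i \<omega>))) borel (snd \<circ> (\<lambda>\<omega>. (x l \<omega>, e l \<omega>)))"
    by (rule indep_var_compose[OF indep_vars_imp_indep_var[OF indep assms(1,2) False]
          measurable_compose[OF fst_measurable \<phi>] snd_measurable])
  then show ?thesis by (simp add: comp_def)
qed (use indep_same assms in simp)

lemma indep_x_x:
  assumes "i \<in> I" "l \<in> I" "i \<noteq> l"
  shows "indep_var borel (x i) borel (x l)"
proof -
  have "indep_var borel (fst \<circ> (\<lambda>\<omega>. (x i \<omega>, e i \<omega>))) borel (fst \<circ> (\<lambda>\<omega>. (x l \<omega>, e l \<omega>)))"
    by (rule indep_var_compose[OF indep_vars_imp_indep_var[OF indep assms] fst_measurable fst_measurable])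
  then show ?thesis by (simp add: comp_def)
qed

lemma indep_e: "indep_vars (\<lambda>_. borel) e I"
proof -
  have "indep_vars (\<lambda>_. borel) (\<lambda>i \<omega>. snd (x i \<omega>, e i \<omega>)) I"
    by (rule indep_vars_compose2[OF indep snd_measurable])
  then show ?thesis by simp
qed

lemma e_moments:
  assumes "i \<in> I"
  shows "integrable M (e i)" "expectation (e i) = 0"
    "integrable M (\<lambda>\<omega>. (e i \<omega>)\<^sup>2)" "expectation (\<lambda>\<omega>. (e i \<omega>)\<^sup>2) \<le> S\<^sup>2"
proof -
  note D = e_normal[OF assms]
  have si: "0 < s i" "s i \<le> S" using s[OF assms] by auto
  show "integrable M (\<lambda>\<omega>. (e i \<omega>)\<^sup>2)"
    using distributed_integrable[OF D, of "\<lambda>u. u\<^sup>2"] integrable_normal_moment[OF si(1), of 0 2] by simp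
  show "integrable M (e i)"
    using distributed_integrable[OF D, of "\<lambda>u. u"] integrable_normal_moment_nz_1[OF si(1), of 0] by simp
  show "expectation (e i) = 0"
    using distributed_integral[OF D, of "\<lambda>u. u"] integral_normal_moment_nz_1[OF si(1), of 0] by simp
  have "expectation (\<lambda>\<omega>. (e i \<omega>)\<^sup>2) = (s i)\<^sup>2"
    using distributed_integral[OF D, of "\<lambda>u. u\<^sup>2"] integral_normal_moment_even[OF si(1), of 0 1]
    by (simp add: fact_2)
  then show "expectation (\<lambda>\<omega>. (e i \<omega>)\<^sup>2) \<le> S\<^sup>2" using si by (simp add: power_mono)
qed

lemma x_moments:
  assumes "i \<in> I"
  shows "integrable M (\<lambda>\<omega>. (norm (x i \<omega>))\<^sup>2)" "expectation (\<lambda>\<omega>. (norm (x i \<omega>))\<^sup>2) = mean_sq"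
    "integrable M (\<lambda>\<omega>. x i \<omega> $ a)"
proof -
  note [measurable] = x_measurable[OF assms]
  show "integrable M (\<lambda>\<omega>. (norm (x i \<omega>))\<^sup>2)"
    using second_moment unfolding x_distr[OF assms, symmetric]
    by (subst (asm) integrable_distr_eq) auto
  show "expectation (\<lambda>\<omega>. (norm (x i \<omega>))\<^sup>2) = mean_sq"
  proof -
    have "mean_sq = (\<integral>v. (norm v)\<^sup>2 \<partial>distr M borel (x i))" by (simp add: mean_sq_def x_distr[OF assms])
    then show ?thesis by (subst (asm) integral_distr) auto
  qed
  interpret F: prob_space F by (rule prob_space_F)
  have "integrable F (\<lambda>v. v $ a)"
    by (rule integrable_component[OF F.finite_measure_axioms sets_F second_moment])
  then show "integrable M (\<lambda>\<omega>. x i \<omega> $ a)"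
    unfolding x_distr[OF assms, symmetric] by (subst (asm) integrable_distr_eq) auto
qed

lemma mean_sq_nonneg: "0 \<le> mean_sq"
  unfolding mean_sq_def by (rule integral_nonneg_AE) simp

text \<open>The union bound over the Gaussian tails of the block sums, whose variances are at most \<open>w * S\<^sup>2\<close>.\<close>

lemma prob_block_error_sum:
  assumes w: "1 \<le> w" "w \<le> T * n0" and \<delta>: "0 \<le> \<delta>"
  shows "prob {\<omega> \<in> space M. \<exists>l\<in>{1..T * n0 - w + 1}. real w * \<delta> \<le> \<bar>\<Sum>i=l..l+w-1. e i \<omega>\<bar>}
    \<le> 2 * real (T * n0) * exp (- real w * \<delta>\<^sup>2 / (2 * S\<^sup>2))"
proof -
  define L where "L = {1..T * n0 - w + 1}"
  define A where "A l = {\<omega> \<in> space M. real w * \<delta> \<le> \<bar>\<Sum>i=l..l+w-1. e i \<omega>\<bar>}" for l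
  have B: "{l..l+w-1} \<subseteq> I" "{l..l+w-1} \<noteq> {}" if "l \<in> L" for l
    using that w by (auto simp: L_def)
  have A_meas: "A l \<in> sets M" if "l \<in> L" for l
  proof -
    have "(\<lambda>\<omega>. \<Sum>i=l..l+w-1. e i \<omega>) \<in> borel_measurable M"
      using B(1)[OF that] e_measurable by (intro borel_measurable_sum) blast
    then show ?thesis unfolding A_def by measurable
  qed
  have A_prob: "prob (A l) \<le> 2 * exp (- real w * \<delta>\<^sup>2 / (2 * S\<^sup>2))" if l: "l \<in> L" for l
  proof -
    let ?B = "{l..l+w-1}"
    have si: "0 < s i \<and> s i \<le> S" if "i \<in> ?B" for i using s B(1)[OF l] that by blast
    have norm: "distributed M lborel (\<lambda>\<omega>. \<Sum>i\<in>?B. e i \<omega>)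
        (normal_density (\<Sum>i\<in>?B. 0) (sqrt (\<Sum>i\<in>?B. (s i)\<^sup>2)))"
      using B[OF l] si e_normal
      by (intro sum_indep_normal indep_vars_subset[OF indep_e]) auto
    have "0 < (\<Sum>i\<in>?B. (s i)\<^sup>2)"
      using B(2)[OF l] by (intro sum_pos zero_less_power) (use si in auto)
    moreover have "(\<Sum>i\<in>?B. (s i)\<^sup>2) \<le> (\<Sum>i\<in>?B. S\<^sup>2)"
      using si by (intro sum_mono power_mono) (auto intro: less_imp_le)
    moreover have "(\<Sum>i\<in>?B. S\<^sup>2) = real w * S\<^sup>2"
      using w by simp
    ultimately have "prob (A l) \<le> 2 * exp (- (real w * \<delta>)\<^sup>2 / (2 * (real w * S\<^sup>2)))"
      unfolding A_def using norm \<delta>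
      by (intro normal_tail[where s = "sqrt (\<Sum>i\<in>?B. (s i)\<^sup>2)"]) auto
    also have "- (real w * \<delta>)\<^sup>2 / (2 * (real w * S\<^sup>2)) = - real w * \<delta>\<^sup>2 / (2 * S\<^sup>2)"
      using w S_pos by (simp add: field_simps power2_eq_square)
    finally show ?thesis .
  qed
  have "prob {\<omega> \<in> space M. \<exists>l\<in>L. real w * \<delta> \<le> \<bar>\<Sum>i=l..l+w-1. e i \<omega>\<bar>} = prob (\<Union>l\<in>L. A l)"
    by (rule arg_cong[where f = prob]) (auto simp: A_def)
  also have "\<dots> \<le> (\<Sum>l\<in>L. prob (A l))"
    using A_meas by (intro finite_measure_subadditive_finite) (auto simp: L_def)
  also have "\<dots> \<le> (\<Sum>l\<in>L. 2 * exp (- real w * \<delta>\<^sup>2 / (2 * S\<^sup>2)))"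
    using A_prob by (intro sum_mono)
  also have "\<dots> = real (card L) * (2 * exp (- real w * \<delta>\<^sup>2 / (2 * S\<^sup>2)))"
    by simp
  also have "\<dots> \<le> real (T * n0) * (2 * exp (- real w * \<delta>\<^sup>2 / (2 * S\<^sup>2)))"
    using w by (intro mult_right_mono) (auto simp: L_def)
  finally show ?thesis unfolding L_def by (simp add: mult_ac)
qed

lemma prob_sum_norm_sq:
  fixes K :: real
  assumes "0 < K"
  shows "prob {\<omega> \<in> space M. K * T \<le> (\<Sum>i\<in>I. (norm (x i \<omega>))\<^sup>2)} \<le> n0 * mean_sq / K"
proof -
  have "expectation (\<lambda>\<omega>. \<Sum>i\<in>I. (norm (x i \<omega>))\<^sup>2) = T * n0 * mean_sq"
    using x_moments by (subst Bochner_Integration.integral_sum) auto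
  then have "prob {\<omega> \<in> space M. K * T \<le> (\<Sum>i\<in>I. (norm (x i \<omega>))\<^sup>2)} \<le> T * n0 * mean_sq / (K * T)"
    using x_moments(1) assms T
    by (intro prob_ge_le_expectation Bochner_Integration.integrable_sum sum_nonneg) auto
  then show ?thesis using T by simp
qed

text \<open>Windows are disjoint, so functions of different windows inherit independence. This serves both
for the score and for the moment matrix of the differences.\<close>

lemma indep_window_functions:
  assumes "\<And>j. j \<in> {1..T} \<Longrightarrow> f j \<in> borel_measurable (\<Pi>\<^sub>M i\<in>window n0 j. borel)"
  shows "indep_vars (\<lambda>_. borel :: real measure) (\<lambda>j \<omega>. f j (\<lambda>i\<in>window n0 j. (x i \<omega>, e i \<omega>))) {1..T}"
proof (rule indep_vars_compose2[OF indep_vars_restrict[OF indep]])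
  show "disjoint_family_on (window n0) {1..T}"
    using window_disjoint by (fastforce simp: disjoint_family_on_def)
qed (use window_subset assms in auto)

lemma sum_sq_deviation_le:
  fixes f :: "'i \<Rightarrow> real"
  shows "(\<Sum>i\<in>A. (f i - (1 / real (card A)) * (\<Sum>l\<in>A. f l))\<^sup>2) \<le> (\<Sum>i\<in>A. (f i)\<^sup>2)"
proof (cases "card A = 0")
  case False
  define c where "c = (1 / real (card A)) * (\<Sum>l\<in>A. f l)"
  have c: "(\<Sum>l\<in>A. f l) = real (card A) * c" using False by (simp add: c_def)
  have "(\<Sum>i\<in>A. (f i - c)\<^sup>2) = (\<Sum>i\<in>A. (f i)\<^sup>2) - 2 * c * (\<Sum>l\<in>A. f l) + real (card A) * c\<^sup>2"
    by (simp add: power2_diff sum.distrib sum_subtractf sum_distrib_left sum_distrib_right mult_ac)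
  also have "\<dots> = (\<Sum>i\<in>A. (f i)\<^sup>2) - real (card A) * c\<^sup>2"
    unfolding c by (simp add: power2_eq_square)
  finally show ?thesis unfolding c_def[symmetric] by simp
qed simp

definition window_score :: "'p \<Rightarrow> nat \<Rightarrow> 'a \<Rightarrow> real" where
  "window_score a j \<omega> =
     (\<Sum>i\<in>window n0 j. e i \<omega> * (x i \<omega> $ a - (1 / real n0) * (\<Sum>l\<in>window n0 j. x l \<omega> $ a)))"

lemma within_score_nth:
  "within_score n0 T (\<lambda>i. x i \<omega>) (\<lambda>i. e i \<omega>) $ a = (\<Sum>j=1..T. window_score a j \<omega>)"
  by (simp add: within_score_def window_mean_def window_score_def)

text \<open>Every product \<open>e i * x l\<close> inside a window has independent factors, also for \<open>i = l\<close>, and a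
centred first factor. The second moment follows from the Cauchy-Schwarz inequality and the fact that
centring lowers a sum of squares; the product of the two sums has \<open>n0\<^sup>2\<close> terms.\<close>

lemma window_score_moments:
  fixes a :: 'p and j :: nat
  assumes j: "j \<in> {1..T}"
  defines "G \<equiv> window_score a j"
  shows "G \<in> borel_measurable M" "expectation G = 0" "integrable M (\<lambda>\<omega>. (G \<omega>)\<^sup>2)"
    "expectation (\<lambda>\<omega>. (G \<omega>)\<^sup>2) \<le> (real n0)\<^sup>2 * (S\<^sup>2 * mean_sq)"
proof -
  let ?W = "window n0 j"
  have W: "i \<in> I" if "i \<in> ?W" for i using window_subset[OF j] that by blast
  have card: "card ?W = n0" using card_window j by simp
  note [measurable] = x_measurable[OF W] e_measurable[OF W]
  show G[measurable]: "G \<in> borel_measurable M"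
    unfolding G_def window_score_def by measurable
  have ex: "integrable M (\<lambda>\<omega>. e i \<omega> * x l \<omega> $ a) \<and> expectation (\<lambda>\<omega>. e i \<omega> * x l \<omega> $ a) = 0"
    if "i \<in> ?W" "l \<in> ?W" for i l
  proof -
    have ind: "indep_var borel (\<lambda>\<omega>. x l \<omega> $ a) borel (e i)"
      using W that by (intro indep_x_e) auto
    show ?thesis
      using indep_var_integrable[OF ind x_moments(3) e_moments(1)] 
        indep_var_lebesgue_integral[OF ind x_moments(3) e_moments(1)] W that e_moments(2)
      by (simp add: mult.commute)
  qed
  have G_eq: "G \<omega> = (\<Sum>i\<in>?W. e i \<omega> * x i \<omega> $ a - (1 / real n0) * (\<Sum>l\<in>?W. e i \<omega> * x l \<omega> $ a))" for \<omega>
    unfolding G_def window_score_def by (intro sum.cong refl) (simp add: right_diff_distrib sum_distrib_left mult_ac)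
  show "expectation G = 0"
    unfolding G_eq using ex by (simp add: Bochner_Integration.integral_sum)
  have sq: "integrable M (\<lambda>\<omega>. (e i \<omega>)\<^sup>2 * (norm (x l \<omega>))\<^sup>2)
      \<and> expectation (\<lambda>\<omega>. (e i \<omega>)\<^sup>2 * (norm (x l \<omega>))\<^sup>2) \<le> S\<^sup>2 * mean_sq" if "i \<in> ?W" "l \<in> ?W" for i l
  proof -
    have "indep_var borel (id \<circ> (\<lambda>\<omega>. (norm (x l \<omega>))\<^sup>2)) borel ((\<lambda>u. u\<^sup>2) \<circ> e i)"
      by (rule indep_var_compose[OF indep_x_e[OF W[OF that(2)] W[OF that(1)]]]) auto
    then have ind: "indep_var borel (\<lambda>\<omega>. (norm (x l \<omega>))\<^sup>2) borel (\<lambda>\<omega>. (e i \<omega>)\<^sup>2)"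
      by (simp add: comp_def)
    have "mean_sq * expectation (\<lambda>\<omega>. (e i \<omega>)\<^sup>2) \<le> mean_sq * S\<^sup>2"
      using e_moments(4) W that mean_sq_nonneg by (intro mult_left_mono) auto
    then show ?thesis
      using indep_var_integrable[OF ind x_moments(1) e_moments(3)]
        indep_var_lebesgue_integral[OF ind x_moments(1) e_moments(3)] W that x_moments(2)
      by (simp add: mult.commute)
  qed
  define D where "D \<omega> = (\<Sum>i\<in>?W. \<Sum>l\<in>?W. (e i \<omega>)\<^sup>2 * (norm (x l \<omega>))\<^sup>2)" for \<omega>
  have D: "integrable M D" unfolding D_def using sq by (intro Bochner_Integration.integrable_sum) auto
  have G_le: "(G \<omega>)\<^sup>2 \<le> D \<omega>" for \<omega>
  proof -
    have "(G \<omega>)\<^sup>2 \<le> (\<Sum>i\<in>?W. (e i \<omega>)\<^sup>2)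
        * (\<Sum>i\<in>?W. (x i \<omega> $ a - (1 / real n0) * (\<Sum>l\<in>?W. x l \<omega> $ a))\<^sup>2)"
      unfolding G_def window_score_def by (rule Cauchy_Schwarz_ineq_sum)
    also have "\<dots> \<le> (\<Sum>i\<in>?W. (e i \<omega>)\<^sup>2) * (\<Sum>l\<in>?W. (x l \<omega> $ a)\<^sup>2)"
      using sum_sq_deviation_le[of "\<lambda>i. x i \<omega> $ a" ?W]
      by (intro mult_left_mono sum_nonneg) (auto simp: card)
    also have "\<dots> \<le> (\<Sum>i\<in>?W. (e i \<omega>)\<^sup>2) * (\<Sum>l\<in>?W. (norm (x l \<omega>))\<^sup>2)"
      by (intro mult_left_mono sum_nonneg sum_mono)
        (auto simp: component_le_norm_cart simp flip: abs_le_square_iff)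
    finally show ?thesis by (simp add: D_def sum_product)
  qed
  show G2: "integrable M (\<lambda>\<omega>. (G \<omega>)\<^sup>2)"
  proof (rule Bochner_Integration.integrable_bound[OF D])
    show "AE \<omega> in M. norm ((G \<omega>)\<^sup>2) \<le> norm (D \<omega>)"
      using G_le by (intro AE_I2) (simp add: order_trans[OF G_le abs_ge_self])
  qed measurable
  have "expectation (\<lambda>\<omega>. (G \<omega>)\<^sup>2) \<le> expectation D"
    using G_le by (intro integral_mono G2 D)
  also have "\<dots> = (\<Sum>i\<in>?W. \<Sum>l\<in>?W. expectation (\<lambda>\<omega>. (e i \<omega>)\<^sup>2 * (norm (x l \<omega>))\<^sup>2))"
    unfolding D_def using sq by (simp add: Bochner_Integration.integral_sum)
  also have "\<dots> \<le> (\<Sum>i\<in>?W. \<Sum>l\<in>?W. S\<^sup>2 * mean_sq)"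
    using sq by (intro sum_mono) blast
  also have "\<dots> = (real n0)\<^sup>2 * (S\<^sup>2 * mean_sq)"
    by (simp add: card power2_eq_square)
  finally show "expectation (\<lambda>\<omega>. (G \<omega>)\<^sup>2) \<le> (real n0)\<^sup>2 * (S\<^sup>2 * mean_sq)" .
qed

text \<open>The coordinates of the score are sums over the independent, centred window scores, so their
second moments add up over the windows and grow only linearly in \<open>T\<close>.\<close>

lemma prob_within_score:
  fixes K :: real
  assumes "0 < K"
  shows "prob {\<omega> \<in> space M. K * T \<le> (norm (within_score n0 T (\<lambda>i. x i \<omega>) (\<lambda>i. e i \<omega>)))\<^sup>2}
    \<le> CARD('p) * (n0\<^sup>2 * (S\<^sup>2 * mean_sq)) / K"
proof -
  define G where "G = window_score"
  note G = window_score_moments[folded G_def]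
  define f :: "'p \<Rightarrow> nat \<Rightarrow> (nat \<Rightarrow> (real ^ 'p) \<times> real) \<Rightarrow> real" where
    "f a j z = (\<Sum>i\<in>window n0 j. snd (z i) * (fst (z i) $ a - (1 / real n0) * (\<Sum>l\<in>window n0 j. fst (z l) $ a)))"
    for a j z
  have [measurable]: "(\<lambda>z. fst (z i)) \<in> borel_measurable (\<Pi>\<^sub>M i\<in>window n0 j. borel :: ((real ^ 'p) \<times> real) measure)"
    "(\<lambda>z. snd (z i)) \<in> borel_measurable (\<Pi>\<^sub>M i\<in>window n0 j. borel :: ((real ^ 'p) \<times> real) measure)"
    if "i \<in> window n0 j" for i j
    by (rule measurable_compose[OF measurable_component_singleton[OF that] fst_measurable])
      (rule measurable_compose[OF measurable_component_singleton[OF that] snd_measurable])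
  have f: "f a j \<in> borel_measurable (\<Pi>\<^sub>M i\<in>window n0 j. borel)" for a j
    unfolding f_def
    by (intro borel_measurable_sum borel_measurable_times borel_measurable_diff borel_measurable_const
        borel_measurable_nth) auto
  have f_G: "(\<lambda>j \<omega>. f a j (\<lambda>i\<in>window n0 j. (x i \<omega>, e i \<omega>))) = G a" for a
    by (intro ext) (simp add: f_def G_def window_score_def)
  have ind: "indep_vars (\<lambda>_. borel) (G a) {1..T}" for a
    using indep_window_functions[of "f a"] f unfolding f_G by blast
  have sum_G: "integrable M (\<lambda>\<omega>. (\<Sum>j=1..T. G a j \<omega>)\<^sup>2)"
    "expectation (\<lambda>\<omega>. (\<Sum>j=1..T. G a j \<omega>)\<^sup>2) \<le> T * (n0\<^sup>2 * (S\<^sup>2 * mean_sq))" for a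
  proof -
    show "integrable M (\<lambda>\<omega>. (\<Sum>j=1..T. G a j \<omega>)\<^sup>2)"
      using G by (intro second_moment_indep_sum(1) ind) auto
    have "expectation (\<lambda>\<omega>. (\<Sum>j=1..T. G a j \<omega>)\<^sup>2) = (\<Sum>j=1..T. expectation (\<lambda>\<omega>. (G a j \<omega>)\<^sup>2))"
      using G by (intro second_moment_indep_sum(2) ind) auto
    also have "\<dots> \<le> (\<Sum>j=1..T. (real n0)\<^sup>2 * (S\<^sup>2 * mean_sq))"
      using G(4) by (intro sum_mono)
    finally show "expectation (\<lambda>\<omega>. (\<Sum>j=1..T. G a j \<omega>)\<^sup>2) \<le> T * (n0\<^sup>2 * (S\<^sup>2 * mean_sq))" by simp
  qed
  have norm_eq: "(norm (within_score n0 T (\<lambda>i. x i \<omega>) (\<lambda>i. e i \<omega>)))\<^sup>2 = (\<Sum>a\<in>UNIV. (\<Sum>j=1..T. G a j \<omega>)\<^sup>2)" for \<omega>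
    unfolding G_def within_score_nth[symmetric] power2_norm_eq_inner
    by (simp add: inner_vec_def power2_eq_square)
  have "expectation (\<lambda>\<omega>. \<Sum>a\<in>UNIV. (\<Sum>j=1..T. G a j \<omega>)\<^sup>2) \<le> (\<Sum>a\<in>(UNIV :: 'p set). T * (n0\<^sup>2 * (S\<^sup>2 * mean_sq)))"
    unfolding Bochner_Integration.integral_sum[OF sum_G(1)] by (intro sum_mono sum_G(2))
  then have "prob {\<omega> \<in> space M. K * T \<le> (\<Sum>a\<in>UNIV. (\<Sum>j=1..T. G a j \<omega>)\<^sup>2)}
      \<le> CARD('p) * (T * (n0\<^sup>2 * (S\<^sup>2 * mean_sq))) / (K * T)"
    using sum_G(1) assms T
    by (intro prob_ge_le_expectation Bochner_Integration.integrable_sum sum_nonneg) auto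
  also have "\<dots> = CARD('p) * (n0\<^sup>2 * (S\<^sup>2 * mean_sq)) / K"
    using T by simp
  finally show ?thesis unfolding norm_eq .
qed

text \<open>Chebyshev's inequality; the shrunken entries are bounded by \<open>1\<close>, so each centred summand has
second moment at most \<open>4\<close>.\<close>

lemma prob_shrunk_moment_deviation:
  fixes \<eta> :: real
  assumes "0 < \<eta>"
  shows "prob {\<omega> \<in> space M. T * \<eta> \<le> \<bar>\<Sum>j=1..T. shrink (window_diff n0 (\<lambda>i. x i \<omega>) j) $ a
            * shrink (window_diff n0 (\<lambda>i. x i \<omega>) j) $ b - shrunk_diff_moment F a b\<bar>} \<le> 4 / (T * \<eta>\<^sup>2)"
proof -
  define h where "h d = shrink d $ a * shrink d $ b" for d :: "real ^ 'p"
  define A where "A = shrunk_diff_moment F a b"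
  define Y where "Y j \<omega> = h (window_diff n0 (\<lambda>i. x i \<omega>) j) - A" for j \<omega>
  interpret F: prob_space F by (rule prob_space_F)
  interpret FF: pair_prob_space F F ..
  note [measurable_cong] = sets_F
  have h_meas [measurable]: "h \<in> borel_measurable borel" unfolding h_def by measurable
  have h_bound: "\<bar>h d\<bar> \<le> 1" for d unfolding h_def by (rule abs_shrink_prod_le)
  have A_bound: "\<bar>A\<bar> \<le> 1"
  proof -
    have "\<bar>A\<bar> \<le> (\<integral>p. \<bar>h (fst p - snd p)\<bar> \<partial>(F \<Otimes>\<^sub>M F))"
      unfolding A_def shrunk_diff_moment_def h_def by (rule integral_abs_bound)
    also have "\<dots> \<le> (\<integral>p. 1 \<partial>(F \<Otimes>\<^sub>M F))"
      by (intro integral_mono FF.integrable_const_bound[where B = 1]) (auto simp: h_bound)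
    finally show ?thesis by (simp add: FF.prob_space)
  qed
  have idx: "1 + (j - 1) * n0 \<in> I" "2 + (j - 1) * n0 \<in> I" if "j \<in> {1..T}" for j
    using window_subset[OF that, of n0] first_two_in_window[OF n0, of j] that by (auto simp del: One_nat_def)
  have mean: "expectation (Y j) = 0" and meas: "Y j \<in> borel_measurable M" if j: "j \<in> {1..T}" for j
  proof -
    define p q where "p = 1 + (j - 1) * n0" and "q = 2 + (j - 1) * n0"
    have diff: "window_diff n0 (\<lambda>i. x i \<omega>) j = x p \<omega> - x q \<omega>" for \<omega>
      by (simp add: window_diff_def p_def q_def)
    have pq: "p \<in> I" "q \<in> I" "p \<noteq> q" using idx[OF j] by (auto simp: p_def q_def)
    note [measurable] = x_measurable[OF pq(1)] x_measurable[OF pq(2)]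
    show "Y j \<in> borel_measurable M" unfolding Y_def diff by measurable
    have joint: "F \<Otimes>\<^sub>M F = distr M (borel \<Otimes>\<^sub>M borel) (\<lambda>\<omega>. (x p \<omega>, x q \<omega>))"
      using indep_x_x[OF pq]
      unfolding indep_var_distribution_eq x_distr[OF pq(1)] x_distr[OF pq(2)] by simp
    have "A = (\<integral>z. h (fst z - snd z) \<partial>(F \<Otimes>\<^sub>M F))"
      by (simp add: A_def shrunk_diff_moment_def h_def)
    also have "\<dots> = expectation (\<lambda>\<omega>. h (x p \<omega> - x q \<omega>))"
      unfolding joint by (subst integral_distr) auto
    finally have "expectation (\<lambda>\<omega>. h (window_diff n0 (\<lambda>i. x i \<omega>) j)) = A"
      by (simp add: diff)
    moreover have "integrable M (\<lambda>\<omega>. h (window_diff n0 (\<lambda>i. x i \<omega>) j))"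
      unfolding diff by (intro integrable_const_bound[where B = 1]) (auto simp: h_bound)
    ultimately show "expectation (Y j) = 0"
      unfolding Y_def by (simp add: prob_space)
  qed
  have Y_sq: "(Y j \<omega>)\<^sup>2 \<le> 4" for j \<omega>
  proof -
    have "\<bar>Y j \<omega>\<bar> \<le> \<bar>2\<bar>"
      using h_bound[of "window_diff n0 (\<lambda>i. x i \<omega>) j"] A_bound unfolding Y_def by linarith
    then show ?thesis unfolding abs_le_square_iff by simp
  qed
  have sq: "integrable M (\<lambda>\<omega>. (Y j \<omega>)\<^sup>2)" if "j \<in> {1..T}" for j
    using meas[OF that] Y_sq by (intro integrable_const_bound[where B = 4]) auto
  define f :: "nat \<Rightarrow> (nat \<Rightarrow> (real ^ 'p) \<times> real) \<Rightarrow> real" where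
    "f j z = h (fst (z (1 + (j - 1) * n0)) - fst (z (2 + (j - 1) * n0))) - A" for j z
  note [measurable] = fst_measurable
  have f: "f j \<in> borel_measurable (\<Pi>\<^sub>M i\<in>window n0 j. borel)" if "j \<in> {1..T}" for j
  proof -
    have [measurable]: "(\<lambda>z. z (1 + (j - 1) * n0)) \<in> borel_measurable (\<Pi>\<^sub>M i\<in>window n0 j. (borel :: ((real ^ 'p) \<times> real) measure))"
      "(\<lambda>z. z (2 + (j - 1) * n0)) \<in> borel_measurable (\<Pi>\<^sub>M i\<in>window n0 j. (borel :: ((real ^ 'p) \<times> real) measure))"
      using first_two_in_window[OF n0, of j] that by (auto intro!: measurable_component_singleton)
    show ?thesis unfolding f_def by measurable
  qed
  have "indep_vars (\<lambda>_. borel) (\<lambda>j \<omega>. f j (\<lambda>i\<in>window n0 j. (x i \<omega>, e i \<omega>))) {1..T}"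
    by (rule indep_window_functions) (rule f)
  also have "?this \<longleftrightarrow> indep_vars (\<lambda>_. borel) Y {1..T}"
    using first_two_in_window[OF n0]
    by (intro indep_vars_cong refl ext) (simp add: f_def Y_def window_diff_def)
  finally have ind: "indep_vars (\<lambda>_. borel) Y {1..T}" .
  have int: "integrable M (\<lambda>\<omega>. (\<Sum>j=1..T. Y j \<omega>)\<^sup>2)"
    using sq mean by (intro second_moment_indep_sum(1) ind) auto
  have "expectation (\<lambda>\<omega>. (\<Sum>j=1..T. Y j \<omega>)\<^sup>2) = (\<Sum>j=1..T. expectation (\<lambda>\<omega>. (Y j \<omega>)\<^sup>2))"
    using sq mean by (intro second_moment_indep_sum(2) ind) auto
  also have "\<dots> \<le> (\<Sum>j=1..T. 4)"
    using sq Y_sq by (intro sum_mono integral_le_const) auto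
  finally have le: "expectation (\<lambda>\<omega>. (\<Sum>j=1..T. Y j \<omega>)\<^sup>2) \<le> 4 * T" by simp
  have "{\<omega> \<in> space M. T * \<eta> \<le> \<bar>\<Sum>j=1..T. Y j \<omega>\<bar>} = {\<omega> \<in> space M. (T * \<eta>)\<^sup>2 \<le> (\<Sum>j=1..T. Y j \<omega>)\<^sup>2}"
    using assms by (simp flip: abs_le_square_iff)
  also have "prob \<dots> \<le> 4 * T / (T * \<eta>)\<^sup>2"
    using int le assms T by (intro prob_ge_le_expectation) auto
  also have "\<dots> = 4 / (T * \<eta>\<^sup>2)"
    using T by (simp add: power2_eq_square)
  finally show ?thesis unfolding Y_def h_def A_def .
qed

text \<open>The sum of the bounds on the four bad events: a large block mean of the noise, a large sum of
squared norms, a large score, and an entry of the moment matrix far from its expectation.\<close>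

definition failure_bound :: "nat \<Rightarrow> real \<Rightarrow> real \<Rightarrow> real \<Rightarrow> real" where
  "failure_bound w \<delta> \<kappa> K =
     2 * real (T * n0) * exp (- real w * (\<delta> / 2)\<^sup>2 / (2 * S\<^sup>2))
     + (n0 * mean_sq / K + CARD('p) * (n0\<^sup>2 * (S\<^sup>2 * mean_sq)) / K)
     + (real CARD('p))\<^sup>2 * (4 / (T * (\<kappa> / (2 * (real CARD('p))\<^sup>2))\<^sup>2))"

text \<open>Off four bad events, the moment matrix bounds the scatter form from below, so that the scatter is
invertible and \<open>b \<omega>\<close> does solve the normal equations; the deterministic estimates then apply.\<close>

lemma block_intercepts_uniformly_close:
  assumes \<kappa>: "0 < \<kappa>" "\<And>v. \<kappa> * (norm v)\<^sup>2 \<le> (\<Sum>a\<in>UNIV. \<Sum>b\<in>UNIV. v $ a * v $ b * shrunk_diff_moment F a b)"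
    and w: "1 \<le> w" "w \<le> T * n0" and \<delta>: "0 < \<delta>"
    and K: "0 < K" "K\<^sup>2 / ((\<kappa> / 4)\<^sup>2 * real w) \<le> (\<delta> / 2)\<^sup>2"
    and y: "\<And>i \<omega>. i \<in> I \<Longrightarrow> \<omega> \<in> space M \<Longrightarrow> y i \<omega> = x i \<omega> \<bullet> \<beta> + m i + e i \<omega>"
    and m: "\<And>j i. j \<in> {1..T} \<Longrightarrow> i \<in> window n0 j \<Longrightarrow> m i = \<mu> j"
    and sol: "\<And>\<omega>. \<omega> \<in> space M \<Longrightarrow> invertible (within_scatter n0 T (\<lambda>i. x i \<omega>)) \<Longrightarrow>
      is_EM_solution n0 T (\<lambda>i. x i \<omega>) (\<lambda>i. y i \<omega>) (b \<omega>)"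
  obtains A where "A \<in> sets M" "prob A \<le> failure_bound w \<delta> \<kappa> K"
    "\<And>\<omega> l. \<omega> \<in> space M - A \<Longrightarrow> l \<in> {1..T * n0 - w + 1} \<Longrightarrow>
      \<bar>block_intercept w (\<lambda>i. x i \<omega>) (\<lambda>i. y i \<omega>) (b \<omega>) l - (1 / real w) * (\<Sum>i=l..l+w-1. m i)\<bar> \<le> \<delta>"
proof -
  define \<eta> where "\<eta> = \<kappa> / (2 * (real CARD('p))\<^sup>2)"
  have \<eta>: "0 < \<eta>" using \<kappa>(1) by (simp add: \<eta>_def)
  define A1 where "A1 = {\<omega> \<in> space M. \<exists>l\<in>{1..T * n0 - w + 1}. real w * (\<delta> / 2) \<le> \<bar>\<Sum>i=l..l+w-1. e i \<omega>\<bar>}"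
  define A2 where "A2 = {\<omega> \<in> space M. K * T \<le> (\<Sum>i\<in>I. (norm (x i \<omega>))\<^sup>2)}"
  define A3 where "A3 = {\<omega> \<in> space M. K * T \<le> (norm (within_score n0 T (\<lambda>i. x i \<omega>) (\<lambda>i. e i \<omega>)))\<^sup>2}"
  define D where "D a c = {\<omega> \<in> space M. T * \<eta> \<le> \<bar>\<Sum>j=1..T. shrink (window_diff n0 (\<lambda>i. x i \<omega>) j) $ a
            * shrink (window_diff n0 (\<lambda>i. x i \<omega>) j) $ c - shrunk_diff_moment F a c\<bar>}" for a c
  define A4 where "A4 = (\<Union>(a, c)\<in>UNIV. D a c)"
  have sum_e: "(\<lambda>\<omega>. \<Sum>i=l..l+w-1. e i \<omega>) \<in> borel_measurable M" if "l \<in> {1..T * n0 - w + 1}" for l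
    using that w by (intro borel_measurable_sum e_measurable) auto
  have "{\<omega> \<in> space M. real w * (\<delta> / 2) \<le> \<bar>\<Sum>i=l..l+w-1. e i \<omega>\<bar>} \<in> sets M"
    if "l \<in> {1..T * n0 - w + 1}" for l
    using sum_e[OF that] by measurable
  then have A1: "A1 \<in> sets M"
    unfolding A1_def by (intro sets.sets_Collect_finite_Ex) auto
  have A2: "A2 \<in> sets M"
  proof -
    have "(\<lambda>\<omega>. \<Sum>i\<in>I. (norm (x i \<omega>))\<^sup>2) \<in> borel_measurable M"
      using x_measurable by (intro borel_measurable_sum borel_measurable_power) auto
    then show ?thesis unfolding A2_def by measurable
  qed
  have A3: "A3 \<in> sets M"
  proof -
    have "(\<lambda>\<omega>. within_score n0 T (\<lambda>i. x i \<omega>) (\<lambda>i. e i \<omega>)) \<in> borel_measurable M"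
      unfolding within_score_def window_mean_def
      using window_subset[of _ T n0] x_measurable e_measurable
      by (intro borel_measurable_sum borel_measurable_scaleR borel_measurable_diff borel_measurable_const)
        blast+
    then show ?thesis unfolding A3_def by measurable
  qed
  have D: "D a c \<in> sets M" for a c
  proof -
    have "window_diff n0 (\<lambda>i. x i \<omega>) j = x (1 + (j - 1) * n0) \<omega> - x (2 + (j - 1) * n0) \<omega>" for j \<omega>
      by (simp add: window_diff_def)
    moreover have "1 + (j - 1) * n0 \<in> I" "2 + (j - 1) * n0 \<in> I" if "j \<in> {1..T}" for j
      using window_subset[OF that, of n0] first_two_in_window[OF n0, of j] that by (auto simp del: One_nat_def)
    ultimately have wd: "(\<lambda>\<omega>. window_diff n0 (\<lambda>i. x i \<omega>) j) \<in> borel_measurable M" if "j \<in> {1..T}" for j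
      using that x_measurable by (simp only:) (intro borel_measurable_diff; blast)
    have "(\<lambda>\<omega>. \<Sum>j=1..T. shrink (window_diff n0 (\<lambda>i. x i \<omega>) j) $ a
            * shrink (window_diff n0 (\<lambda>i. x i \<omega>) j) $ c - shrunk_diff_moment F a c) \<in> borel_measurable M"
      by (intro borel_measurable_sum borel_measurable_diff borel_measurable_times borel_measurable_const
          borel_measurable_nth measurable_compose[OF wd borel_measurable_shrink])
    then show ?thesis unfolding D_def by measurable
  qed
  have A4: "A4 \<in> sets M" unfolding A4_def using D by auto
  have A4_prob: "prob A4 \<le> (real CARD('p))\<^sup>2 * (4 / (T * \<eta>\<^sup>2))"
  proof -
    have "prob A4 \<le> (\<Sum>(a, c)\<in>UNIV. prob (D a c))"
      unfolding A4_def case_prod_beta' using D by (intro finite_measure_subadditive_finite) auto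
    also have "\<dots> \<le> (\<Sum>(a :: 'p, c :: 'p)\<in>UNIV. 4 / (T * \<eta>\<^sup>2))"
    proof -
      have "prob (D a c) \<le> 4 / (T * \<eta>\<^sup>2)" for a c
        unfolding D_def using prob_shrunk_moment_deviation[OF \<eta>, of a c] .
      then show ?thesis by (intro sum_mono) (simp add: case_prod_beta')
    qed
    also have "\<dots> = (real CARD('p))\<^sup>2 * (4 / (T * \<eta>\<^sup>2))"
      by (simp add: card_cartesian_product power2_eq_square flip: UNIV_Times_UNIV)
    finally show ?thesis .
  qed
  define A where "A = A1 \<union> (A2 \<union> A3) \<union> A4"
  have "prob A \<le> prob A1 + (prob A2 + prob A3) + prob A4"
    unfolding A_def using A1 A2 A3 A4
    by (meson add_mono measure_Un_le order_refl order_trans sets.Un)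
  also have "\<dots> \<le> failure_bound w \<delta> \<kappa> K"
    unfolding failure_bound_def
    using prob_block_error_sum[OF w, of "\<delta> / 2"] prob_sum_norm_sq[OF K(1)] prob_within_score[OF K(1)] A4_prob \<delta>
    unfolding A1_def A2_def A3_def \<eta>_def by (intro add_mono) auto
  finally have prob: "prob A \<le> failure_bound w \<delta> \<kappa> K" .
  show thesis
  proof (rule that[OF _ prob])
    show "A \<in> sets M" unfolding A_def using A1 A2 A3 A4 by auto
    fix \<omega> l assume \<omega>: "\<omega> \<in> space M - A" and l: "l \<in> {1..T * n0 - w + 1}"
    let ?x = "\<lambda>i. x i \<omega>" and ?e = "\<lambda>i. e i \<omega>" and ?y = "\<lambda>i. y i \<omega>"
    have "\<bar>\<Sum>j=1..T. shrink (window_diff n0 ?x j) $ a * shrink (window_diff n0 ?x j) $ c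
        - shrunk_diff_moment F a c\<bar> \<le> T * \<eta>" for a c
    proof -
      have "\<omega> \<notin> D a c" using \<omega> unfolding A_def A4_def by auto
      then show ?thesis using \<omega> unfolding D_def by (simp add: not_le less_imp_le)
    qed
    then have form: "(\<kappa> / 4) * T * (norm v)\<^sup>2 \<le> within_form n0 T ?x v" for v
      unfolding \<eta>_def by (rule within_form_ge_of_moments[OF n0 \<kappa>(2)])
    have \<kappa>T: "0 < \<kappa> / 4 * T" using \<kappa>(1) T by simp
    have sol_\<omega>: "is_EM_solution n0 T ?x ?y (b \<omega>)"
      using \<omega> by (intro sol invertible_within_scatter[OF \<kappa>T form]) auto
    have score: "\<kappa> / 4 * T * norm (b \<omega> - \<beta>) \<le> norm (within_score n0 T ?x ?e)"
    proof (rule EM_error_le_score[OF _ \<kappa>T form sol_\<omega>])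
      show "m i = \<mu> j" if "j \<in> {1..T}" "i \<in> window n0 j" for j i
        using m[OF that] .
      show "y i \<omega> = x i \<omega> \<bullet> \<beta> + m i + e i \<omega>" if "i \<in> {1..T * n0}" for i
        using y[OF that] \<omega> by simp
    qed (use n0 in simp)
    show "\<bar>block_intercept w ?x ?y (b \<omega>) l - (1 / real w) * (\<Sum>i=l..l+w-1. m i)\<bar> \<le> \<delta>"
    proof (rule block_intercept_error_le[where n = "T * n0" and \<kappa> = "\<kappa> / 4" and T = T and K = K
            and \<beta> = \<beta> and e = ?e and g = "within_score n0 T ?x ?e"])
      show "\<bar>\<Sum>i=l..l+w-1. e i \<omega>\<bar> \<le> real w * (\<delta> / 2)"
        using \<omega> l unfolding A_def A1_def by force
      show "(\<Sum>i=1..T * n0. (norm (x i \<omega>))\<^sup>2) \<le> K * real T"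
        using \<omega> unfolding A_def A2_def by force
      show "(norm (within_score n0 T ?x ?e))\<^sup>2 \<le> K * real T"
        using \<omega> unfolding A_def A3_def by force
      show "y i \<omega> = x i \<omega> \<bullet> \<beta> + m i + e i \<omega>" if "i \<in> {1..T * n0}" for i
        using y[OF that] \<omega> by simp
    qed (use w l \<kappa>(1) T \<delta> K score in simp_all)
  qed
qed

end

section \<open>The regression model as a window regression\<close>

text \<open>Of the mutual independence in \<open>indep_triple\<close> only the first and third variable are kept, after
composition with real functions.\<close>

lemma (in prob_space) indep_triple_imp_indep_var:
  assumes "indep_triple N1 X N2 Z N3 Y" "\<phi> \<in> borel_measurable N1" "\<psi> \<in> borel_measurable N3"
  shows "indep_var borel (\<lambda>\<omega>. \<phi> (X \<omega>) :: real) borel (\<lambda>\<omega>. \<psi> (Y \<omega>) :: real)"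
proof -
  have X: "random_variable N1 X" and Y: "random_variable N3 Y"
    and ind: "indep_sets (\<lambda>m::nat. if m = 1 then {X -` A \<inter> space M | A. A \<in> sets N1}
                         else if m = 2 then {Z -` A \<inter> space M | A. A \<in> sets N2}
                         else {Y -` A \<inter> space M | A. A \<in> sets N3}) {1, 2, 3}"
    using assms(1) unfolding indep_triple_def by auto
  let ?X = "\<lambda>\<omega>. \<phi> (X \<omega>)" and ?Y = "\<lambda>\<omega>. \<psi> (Y \<omega>)"
  have X': "random_variable borel ?X" and Y': "random_variable borel ?Y"
    using measurable_compose[OF X assms(2)] measurable_compose[OF Y assms(3)] by auto
  have "indep_set {?X -` A \<inter> space M | A. A \<in> sets borel} {?Y -` A \<inter> space M | A. A \<in> sets borel}"
  proof (rule indep_setI)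
    show "{?X -` A \<inter> space M | A. A \<in> sets borel} \<subseteq> events" "{?Y -` A \<inter> space M | A. A \<in> sets borel} \<subseteq> events"
      using X' Y' by (auto intro: measurable_sets)
    fix a b assume "a \<in> {?X -` A \<inter> space M | A. A \<in> sets borel}" "b \<in> {?Y -` A \<inter> space M | A. A \<in> sets borel}"
    then obtain A B where A: "A \<in> sets borel" "a = ?X -` A \<inter> space M" and B: "B \<in> sets borel" "b = ?Y -` B \<inter> space M"
      by blast
    have a: "a = X -` (\<phi> -` A \<inter> space N1) \<inter> space M" "\<phi> -` A \<inter> space N1 \<in> sets N1"
      using A measurable_space[OF X] assms(2) by (auto intro: measurable_sets)
    have b: "b = Y -` (\<psi> -` B \<inter> space N3) \<inter> space M" "\<psi> -` B \<inter> space N3 \<in> sets N3"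
      using B measurable_space[OF Y] assms(3) by (auto intro: measurable_sets)
    have "prob (\<Inter>j\<in>{1, 3 :: nat}. if j = 1 then a else b) = (\<Prod>j\<in>{1, 3 :: nat}. prob (if j = 1 then a else b))"
    proof (rule indep_setsD[OF ind])
      have "a \<in> {X -` A \<inter> space M | A. A \<in> sets N1}" "b \<in> {Y -` A \<inter> space M | A. A \<in> sets N3}"
        using a b by blast+
      then show "\<forall>j\<in>{1, 3 :: nat}. (if j = 1 then a else b) \<in>
          (if j = 1 then {X -` A \<inter> space M | A. A \<in> sets N1}
           else if j = 2 then {Z -` A \<inter> space M | A. A \<in> sets N2}
           else {Y -` A \<inter> space M | A. A \<in> sets N3})"
        by simp
    qed auto
    then show "prob (a \<inter> b) = prob a * prob b" by (simp add: Int_commute)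
  qed
  then have "indep_sets (case_bool {?X -` A \<inter> space M | A. A \<in> sets borel} {?Y -` A \<inter> space M | A. A \<in> sets borel}) UNIV"
    by (simp add: indep_set_def)
  also have "case_bool {?X -` A \<inter> space M | A. A \<in> sets borel} {?Y -` A \<inter> space M | A. A \<in> sets borel}
    = (\<lambda>i. {case_bool ?X ?Y i -` A \<inter> space M | A. A \<in> sets (case_bool borel borel i)})"
    by (simp add: fun_eq_iff split: bool.split)
  finally show ?thesis
    unfolding indep_var_def indep_vars_def2 using X' Y' by (simp split: bool.split)
qed

lemma (in prob_space) indep_var_cong_AE:
  assumes "indep_var S X N Y" "random_variable N Y'" "AE \<omega> in M. Y \<omega> = Y' \<omega>"
  shows "indep_var S X N Y'"
proof -
  have XY: "random_variable S X" "random_variable N Y"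
    and eq: "distr M S X \<Otimes>\<^sub>M distr M N Y = distr M (S \<Otimes>\<^sub>M N) (\<lambda>\<omega>. (X \<omega>, Y \<omega>))"
    using assms(1) by (auto simp: indep_var_distribution_eq)
  have "distr M N Y' = distr M N Y"
    using assms XY by (intro distr_cong_AE) auto
  moreover have "distr M (S \<Otimes>\<^sub>M N) (\<lambda>\<omega>. (X \<omega>, Y' \<omega>)) = distr M (S \<Otimes>\<^sub>M N) (\<lambda>\<omega>. (X \<omega>, Y \<omega>))"
    using assms XY by (intro distr_cong_AE) auto
  ultimately show ?thesis
    using eq XY assms(2) by (simp add: indep_var_distribution_eq)
qed

lemma ex_sample_index:
  assumes "i \<in> {1..\<Sum>j=1..k. N j}"
  obtains j where "j \<in> {1..k}" "i \<in> sample_indices N j"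
proof -
  define j where "j = (LEAST j. i \<le> (\<Sum>l=1..j. N l))"
  have P: "i \<le> (\<Sum>l=1..k. N l)" using assms by simp
  have 1: "i \<le> (\<Sum>l=1..j. N l)" unfolding j_def by (rule LeastI[where P = "\<lambda>j. i \<le> (\<Sum>l=1..j. N l)", OF P])
  have 2: "j \<le> k" unfolding j_def using P by (rule Least_le)
  have 3: "j \<noteq> 0" using 1 assms by (intro notI) simp
  have "\<not> i \<le> (\<Sum>l=1..j - 1. N l)"
    using not_less_Least[of "j - 1" "\<lambda>j. i \<le> (\<Sum>l=1..j. N l)"] 3 unfolding j_def[symmetric] by simp
  moreover have "{1..j - 1} = {1..<j}" using 3 by auto
  ultimately have "i \<in> sample_indices N j" using 1 by (simp add: sample_indices_def)
  then show thesis using that[of j] 2 3 by simp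
qed

text \<open>The sample containing the last index of the window starts after a multiple of \<open>n0\<close>, hence
not later than the window does.\<close>

lemma window_in_one_sample:
  assumes n0: "1 \<le> n0" and n: "(\<Sum>j=1..k. N j) = T * n0"
    and dvd: "\<And>j. j \<in> {1..k} \<Longrightarrow> n0 dvd N j" and j: "j \<in> {1..T}"
  obtains J where "J \<in> {1..k}" "window n0 j \<subseteq> sample_indices N J"
proof -
  have "1 * 1 \<le> j * n0" "j * n0 \<le> T * n0" using j n0 by (intro mult_le_mono; simp)+
  then have "j * n0 \<in> {1..\<Sum>j=1..k. N j}" unfolding n by simp
  then obtain J where J: "J \<in> {1..k}" "j * n0 \<in> sample_indices N J" using ex_sample_index by blast
  define q where "q = (\<Sum>l=1..<J. N l)"
  have "n0 dvd q" unfolding q_def using J(1) by (intro dvd_sum dvd) auto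
  then obtain r where r: "q = r * n0" by (auto simp: dvd_def mult.commute)
  have "q < j * n0" using J(2) by (simp add: sample_indices_def q_def)
  then have "r \<le> j - 1" unfolding r using n0 by simp
  then have "q \<le> (j - 1) * n0" unfolding r by (rule mult_right_mono) simp
  then have "window n0 j \<subseteq> sample_indices N J"
    using J(2) unfolding window_def sample_indices_def q_def by auto
  then show thesis using that J(1) by blast
qed

context k_sample_regression
begin

definition mean_intercept :: "nat \<Rightarrow> real" where
  "mean_intercept i = expectation (\<nu> i)"

definition noise :: "nat \<Rightarrow> 'a \<Rightarrow> real" where
  "noise i \<omega> = y i \<omega> - x i \<omega> \<bullet> \<beta> - mean_intercept i"

lemma intercept_AE_const:
  assumes "j \<in> {1..k}" "i \<in> sample_indices N j" "i \<in> {1..n}"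
  shows "AE \<omega> in M. \<nu> i \<omega> = c j" "mean_intercept i = c j"
proof -
  have [measurable]: "\<nu> i \<in> borel_measurable M"
    using indep_within[OF assms(3)] by (simp add: indep_triple_def)
  have "AE t in distr M borel (\<nu> i). t = c j"
    unfolding nu_distr[OF assms(1,2)] by (simp add: AE_return)
  then show *: "AE \<omega> in M. \<nu> i \<omega> = c j"
    by (subst (asm) AE_distr_iff) auto
  have "expectation (\<nu> i) = expectation (\<lambda>_. c j)"
    using * by (intro integral_cong_AE) auto
  then show "mean_intercept i = c j" by (simp add: mean_intercept_def prob_space)
qed

text \<open>The sum of intercept and error, minus the constant mean intercept, equals \<open>\<epsilon> i\<close> almost surely. So
\<open>noise i\<close> has the law of \<open>\<epsilon> i\<close> and its independence of \<open>x i\<close>, while independence over \<open>i\<close> comes from that of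
the observations.\<close>

lemma ex_window_regression:
  assumes "2 \<le> n0" "1 \<le> T" and n: "n = T * n0"
    and "integrable F (\<lambda>v. (norm v)\<^sup>2)"
  obtains s where "window_regression M n0 T F x noise s sigma_hi"
proof -
  define J where "J i = (SOME j. j \<in> {1..k} \<and> i \<in> sample_indices N j)" for i
  have J: "J i \<in> {1..k} \<and> i \<in> sample_indices N (J i)" if "i \<in> {1..n}" for i
    unfolding J_def by (rule someI_ex) (use that total_size ex_sample_index[where i = i and k = k and N = N] in auto)
  have cont: "(\<lambda>p :: (real ^ 'p) \<times> real. (fst p, snd p - fst p \<bullet> \<beta> - mean_intercept i)) \<in> borel_measurable borel" for i
    by (intro borel_measurable_continuous_onI continuous_intros)
  have indep: "indep_vars (\<lambda>_. borel) (\<lambda>i \<omega>. (x i \<omega>, noise i \<omega>)) {1..n}"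
    using indep_vars_compose2[OF indep_across, of "\<lambda>i p. (fst p, snd p - fst p \<bullet> \<beta> - mean_intercept i)" "\<lambda>_. borel"]
    using cont by (simp add: noise_def)
  have noise_meas: "noise i \<in> borel_measurable M" if "i \<in> {1..n}" for i
  proof -
    have 1: "snd \<in> borel_measurable (borel :: ((real ^ 'p) \<times> real) measure)"
      by (intro borel_measurable_continuous_onI continuous_intros)
    have 2: "(\<lambda>\<omega>. (x i \<omega>, noise i \<omega>)) \<in> borel_measurable M"
      using indep that by (simp add: indep_vars_def)
    show ?thesis using measurable_compose[OF 2 1] by simp
  qed
  have noise_AE: "AE \<omega> in M. \<epsilon> i \<omega> = noise i \<omega>" if i: "i \<in> {1..n}" for i
  proof -
    have "AE \<omega> in M. \<nu> i \<omega> = mean_intercept i"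
      using intercept_AE_const[of "J i" i] J[OF i] i by simp
    then show ?thesis
      using AE_space by eventually_elim (simp add: noise_def response[OF i])
  qed
  have eps: "distributed M lborel (\<epsilon> i) (normal_density 0 (\<sigma> (J i)))" if "i \<in> {1..n}" for i
    using eps_distr J[OF that] by blast
  have "window_regression M n0 T F x noise (\<lambda>i. \<sigma> (J i)) sigma_hi"
  proof (intro window_regression.intro window_regression_axioms.intro prob_space_axioms, unfold n[symmetric])
    show "indep_vars (\<lambda>_. borel) (\<lambda>i \<omega>. (x i \<omega>, noise i \<omega>)) {1..n}" by (rule indep)
    show "indep_var borel (\<lambda>\<omega>. \<phi> (x i \<omega>) :: real) borel (noise i)"
      if i: "i \<in> {1..n}" and \<phi>: "\<phi> \<in> borel_measurable borel" for i \<phi>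
    proof -
      have "indep_var borel (\<lambda>\<omega>. \<phi> (x i \<omega>)) borel (\<epsilon> i)"
        using indep_triple_imp_indep_var[OF indep_within[OF i] \<phi>, of "\<lambda>t. t"] by simp
      then show ?thesis
        by (rule indep_var_cong_AE[OF _ noise_meas[OF i] noise_AE[OF i]])
    qed
    show "distributed M lborel (noise i) (normal_density 0 (\<sigma> (J i)))" if i: "i \<in> {1..n}" for i
    proof -
      have "distr M lborel (noise i) = distr M lborel (\<epsilon> i)"
        using noise_AE[OF i] noise_meas[OF i] distributed_measurable[OF eps[OF i]]
        by (intro distr_cong_AE) auto
      then show ?thesis
        using eps[OF i] noise_meas[OF i] by (simp add: distributed_def)
    qed
    show "0 < \<sigma> (J i) \<and> \<sigma> (J i) \<le> sigma_hi" if "i \<in> {1..n}" for i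
      using sigma_mem[of "J i"] J[OF that] sigma_bounds by auto
    show "distr M borel (x i) = F" if "i \<in> {1..n}" for i using x_distr[OF that] .
  qed (rule assms)+
  then show thesis by (rule that)
qed

end

section \<open>Consistency\<close>

text \<open>Once \<open>w \<ge> (2 / c) ln n\<close>, the exponential is at most \<open>1 / n\<^sup>2\<close>.\<close>

lemma gaussian_union_bound_tendsto_0:
  fixes w n :: "nat \<Rightarrow> nat" and c :: real
  assumes n: "filterlim n at_top sequentially" and c: "0 < c"
    and w_log: "filterlim (\<lambda>T. real (w T) / ln (real (n T))) at_top sequentially"
  shows "(\<lambda>T. 2 * real (n T) * exp (- real (w T) * c)) \<longlonglongrightarrow> 0"
proof (rule tendsto_sandwich[OF _ _ tendsto_const])
  have ev: "\<forall>\<^sub>F T in sequentially. 2 \<le> n T" "\<forall>\<^sub>F T in sequentially. 2 / c \<le> real (w T) / ln (real (n T))"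
    using n w_log by (auto simp: filterlim_at_top)
  show "\<forall>\<^sub>F T in sequentially. 2 * real (n T) * exp (- real (w T) * c) \<le> 2 * inverse (real (n T))"
    using ev
  proof eventually_elim
    case (elim T)
    have ln: "0 < ln (real (n T))" using elim by simp
    have "2 * ln (real (n T)) \<le> real (w T) * c"
      using elim(2) c ln by (simp add: field_simps)
    then have "exp (- real (w T) * c) \<le> exp (- ln (real (n T)) + - ln (real (n T)))" by simp
    also have "\<dots> = inverse (real (n T)) * inverse (real (n T))"
      unfolding exp_add using elim by (simp add: exp_minus)
    finally have "2 * real (n T) * exp (- real (w T) * c)
        \<le> 2 * real (n T) * (inverse (real (n T)) * inverse (real (n T)))"
      by (intro mult_left_mono) auto
    then show ?case using elim by (simp add: mult.assoc[symmetric])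
  qed
  have "filterlim (\<lambda>T. real (n T)) at_top sequentially"
    by (rule filterlim_compose[OF filterlim_real_sequentially n])
  then show "(\<lambda>T. 2 * inverse (real (n T))) \<longlonglongrightarrow> 0"
    using tendsto_mult_right_zero[OF tendsto_inverse_0_at_top] by blast
qed auto

lemma conv_prob_zeroI:
  assumes "\<forall>\<^sub>F T in sequentially. prob_space (M T)"
    and meas: "\<forall>\<^sub>F T in sequentially. Z T \<in> borel_measurable (M T)"
    and bound: "\<And>\<delta>. 0 < \<delta> \<Longrightarrow> \<exists>r. r \<longlonglongrightarrow> 0 \<and> (\<forall>\<^sub>F T in sequentially.
      \<exists>A\<in>sets (M T). measure (M T) A \<le> r T \<and> (\<forall>\<omega>\<in>space (M T) - A. \<bar>Z T \<omega>\<bar> \<le> \<delta>))"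
  shows "conv_prob_zero M Z"
  unfolding conv_prob_zero_def
proof (intro conjI allI impI meas)
  fix \<delta> :: real assume "0 < \<delta>"
  then obtain r where r: "r \<longlonglongrightarrow> 0" and ev: "\<forall>\<^sub>F T in sequentially.
      \<exists>A\<in>sets (M T). measure (M T) A \<le> r T \<and> (\<forall>\<omega>\<in>space (M T) - A. \<bar>Z T \<omega>\<bar> \<le> \<delta>)"
    using bound by blast
  show "(\<lambda>T. measure (M T) {\<omega> \<in> space (M T). \<delta> < \<bar>Z T \<omega>\<bar>}) \<longlonglongrightarrow> 0"
  proof (rule tendsto_sandwich[OF _ _ tendsto_const r])
    show "\<forall>\<^sub>F T in sequentially. measure (M T) {\<omega> \<in> space (M T). \<delta> < \<bar>Z T \<omega>\<bar>} \<le> r T"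
      using ev assms(1)
    proof eventually_elim
      case (elim T)
      then obtain A where A: "A \<in> sets (M T)" "measure (M T) A \<le> r T"
        "\<And>\<omega>. \<omega> \<in> space (M T) - A \<Longrightarrow> \<bar>Z T \<omega>\<bar> \<le> \<delta>" by blast
      interpret prob_space "M T" by (rule elim(2))
      have "measure (M T) {\<omega> \<in> space (M T). \<delta> < \<bar>Z T \<omega>\<bar>} \<le> measure (M T) A"
      proof (rule finite_measure_mono)
        show "{\<omega> \<in> space (M T). \<delta> < \<bar>Z T \<omega>\<bar>} \<subseteq> A" using A(3) by force
      qed (rule A(1))
      then show ?case using A(2) by simp
    qed
  qed simp
qed

lemma integrable_norm_sq_of_cube:
  fixes F :: "(real ^ 'p) measure"
  assumes "finite_measure F" "sets F = sets borel" "integrable F (\<lambda>v. norm v ^ 3)"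
  shows "integrable F (\<lambda>v. (norm v)\<^sup>2)"
proof -
  interpret finite_measure F by fact
  note [measurable_cong] = assms(2)
  have le: "(norm v)\<^sup>2 \<le> 1 + norm v ^ 3" for v :: "real ^ 'p"
  proof (cases "norm v \<le> 1")
    case True
    then have "(norm v)\<^sup>2 \<le> 1" by (simp add: power_le_one)
    then show ?thesis by (simp add: add_increasing2)
  next
    case False
    then have "(norm v)\<^sup>2 \<le> norm v ^ 3" by (intro power_increasing) auto
    then show ?thesis by simp
  qed
  show ?thesis
  proof (rule Bochner_Integration.integrable_bound)
    show "integrable F (\<lambda>v. 1 + norm v ^ 3)" using assms(3) by simp
    show "AE v in F. norm ((norm v)\<^sup>2) \<le> norm (1 + norm v ^ 3)"
      using le by (intro AE_I2) (simp add: abs_of_nonneg)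
  qed measurable
qed

theorem theorem4:
  fixes M :: "nat \<Rightarrow> 'a measure"
    and n0 T0 :: nat
    and k :: "nat \<Rightarrow> nat" and N :: "nat \<Rightarrow> nat \<Rightarrow> nat"
    and c \<sigma> :: "nat \<Rightarrow> nat \<Rightarrow> real"
    and F :: "(real ^ 'p) measure" and \<beta> :: "real ^ 'p"
    and mu_lo mu_hi sigma_lo sigma_hi :: real
    and x :: "nat \<Rightarrow> nat \<Rightarrow> 'a \<Rightarrow> real ^ 'p"
    and \<nu> \<epsilon> y :: "nat \<Rightarrow> nat \<Rightarrow> 'a \<Rightarrow> real"
    and beta_EM :: "nat \<Rightarrow> 'a \<Rightarrow> real ^ 'p"
    and w :: "nat \<Rightarrow> nat"
  assumes n0: "2 \<le> n0"
    and model: "\<And>T. T0 \<le> T \<Longrightarrow>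
      k_sample_regression (M T) (T * n0) (k T) (N T) (c T) (\<sigma> T) F \<beta>
        mu_lo mu_hi sigma_lo sigma_hi (x T) (\<nu> T) (\<epsilon> T) (y T)"
    and x_indep: "\<And>T. T0 \<le> T \<Longrightarrow>
      prob_space.indep_vars (M T) (\<lambda>_. borel) (x T) {1..T * n0}"
    and sizes: "\<And>T j. T0 \<le> T \<Longrightarrow> j \<in> {1..k T} \<Longrightarrow> n0 < N T j \<and> n0 dvd N T j"
    and third_moment: "integrable F (\<lambda>v. norm v ^ 3)"
    and Sigma_pd: "positive_definite (covariance_matrix F)"
    and beta_EM_measurable: "\<And>T. T0 \<le> T \<Longrightarrow> beta_EM T \<in> borel_measurable (M T)"
    and beta_EM: "\<And>T \<omega>. T0 \<le> T \<Longrightarrow> \<omega> \<in> space (M T) \<Longrightarrow>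
      invertible (within_scatter n0 T (\<lambda>i. x T i \<omega>)) \<Longrightarrow>
      is_EM_solution n0 T (\<lambda>i. x T i \<omega>) (\<lambda>i. y T i \<omega>) (beta_EM T \<omega>)"
    and w_range: "\<And>T. T0 \<le> T \<Longrightarrow> n0 < w T \<and> w T \<le> T * n0"
    and w_infinity: "filterlim w at_top sequentially"
    and w_small: "(\<lambda>T. real (w T)) \<in> o(\<lambda>T. real (T * n0))"
    and w_log: "filterlim (\<lambda>T. real (w T) / ln (real (T * n0))) at_top sequentially"
  shows "conv_prob_zero M (\<lambda>T \<omega>.
           EMMB_upper (T * n0) (w T) (\<lambda>i. x T i \<omega>) (\<lambda>i. y T i \<omega>) (beta_EM T \<omega>)
             - robust_upper (M T) (T * n0) (w T) (\<nu> T))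
       \<and> conv_prob_zero M (\<lambda>T \<omega>.
           EMMB_lower (T * n0) (w T) (\<lambda>i. x T i \<omega>) (\<lambda>i. y T i \<omega>) (beta_EM T \<omega>)
             - robust_lower (M T) (T * n0) (w T) (\<nu> T))"
proof -
  define a where "a T \<omega> l = block_intercept (w T) (\<lambda>i. x T i \<omega>) (\<lambda>i. y T i \<omega>) (beta_EM T \<omega>) l" for T \<omega> l
  define L where "L T = {1..T * n0 - w T + 1}" for T
  have L: "finite (L T)" "L T \<noteq> {}" for T by (simp_all add: L_def)
  have late: "\<forall>\<^sub>F T in sequentially. max T0 1 \<le> T" by (rule eventually_ge_at_top)

  have F: "prob_space F" "sets F = sets borel"
  proof -
    define T where "T = max T0 1"
    interpret k_sample_regression "M T" "T * n0" "k T" "N T" "c T" "\<sigma> T" F \<beta>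
      mu_lo mu_hi sigma_lo sigma_hi "x T" "\<nu> T" "\<epsilon> T" "y T"
      by (rule model) (simp add: T_def)
    have 1: "1 \<in> {1..T * n0}" using n0 by (simp add: T_def max_def)
    have "(\<lambda>\<omega>. x T 1 \<omega>) \<in> borel_measurable (M T)"
      using indep_within[OF 1] by (simp add: indep_triple_def)
    then show "prob_space F" "sets F = sets borel"
      using x_distr[OF 1] prob_space_distr by (metis, metis sets_distr)
  qed
  have sq: "integrable F (\<lambda>v. (norm v)\<^sup>2)"
    using F third_moment by (intro integrable_norm_sq_of_cube prob_space.finite_measure)
  obtain \<kappa> where \<kappa>: "0 < \<kappa>"
    "\<And>v. \<kappa> * (norm v)\<^sup>2 \<le> (\<Sum>a\<in>UNIV. \<Sum>b\<in>UNIV. v $ a * v $ b * shrunk_diff_moment F a b)"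
    using shrunk_diff_moment_positive_definite[OF F sq Sigma_pd] by blast

  \<comment> \<open>Uniform closeness of the block intercepts, with failure probability \<open>r T\<close> tending to zero.\<close>
  have close: "\<exists>r. r \<longlonglongrightarrow> 0 \<and> (\<forall>\<^sub>F T in sequentially. \<exists>A\<in>sets (M T). measure (M T) A \<le> r T \<and>
      (\<forall>\<omega>\<in>space (M T) - A. \<forall>l\<in>L T. \<bar>a T \<omega> l - block_mu (M T) (w T) (\<nu> T) l\<bar> \<le> \<delta>))"
    if \<delta>: "0 < \<delta>" for \<delta>
  proof -
    \<comment> \<open>\<open>K\<close> tends to infinity, so the Markov bounds vanish, but \<open>K\<^sup>2 / w\<close> still tends to zero.\<close>
    define K where "K T = sqrt (sqrt (real (w T)))" for T
    define V where "V = (\<integral>v. (norm v)\<^sup>2 \<partial>F)"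
    define P where "P = real CARD('p)"
    define r where "r T = 2 * real (T * n0) * exp (- real (w T) * ((\<delta> / 2)\<^sup>2 / (2 * sigma_hi\<^sup>2)))
      + (n0 * V / K T + P * (n0\<^sup>2 * (sigma_hi\<^sup>2 * V)) / K T)
      + P\<^sup>2 * (4 / (T * (\<kappa> / (2 * P\<^sup>2))\<^sup>2))" for T
    have sigma_hi: "0 < sigma_hi"
    proof -
      interpret k_sample_regression "M T0" "T0 * n0" "k T0" "N T0" "c T0" "\<sigma> T0" F \<beta>
        mu_lo mu_hi sigma_lo sigma_hi "x T0" "\<nu> T0" "\<epsilon> T0" "y T0"
        by (rule model) simp
      show ?thesis using sigma_bounds by linarith
    qed
    have w_real: "filterlim (\<lambda>T. real (w T)) at_top sequentially"
      by (rule filterlim_compose[OF filterlim_real_sequentially w_infinity])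
    have sqrt_w: "filterlim (\<lambda>T. sqrt (real (w T))) at_top sequentially"
      by (rule filterlim_compose[OF sqrt_at_top w_real])
    have K_top: "filterlim K at_top sequentially"
      unfolding K_def by (rule filterlim_compose[OF sqrt_at_top sqrt_w])
    have n_top: "filterlim (\<lambda>T. T * n0) at_top sequentially"
      using n0 by (intro filterlim_at_top_mono[OF filterlim_ident] always_eventually) simp
    have "r \<longlonglongrightarrow> 0 + (0 + 0) + P\<^sup>2 * 0"
      unfolding r_def
    proof (intro tendsto_add tendsto_mult tendsto_const)
      show "(\<lambda>T. 2 * real (T * n0) * exp (- real (w T) * ((\<delta> / 2)\<^sup>2 / (2 * sigma_hi\<^sup>2)))) \<longlonglongrightarrow> 0"
        using \<delta> sigma_hi by (intro gaussian_union_bound_tendsto_0 n_top w_log) simp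
      show "(\<lambda>T. n0 * V / K T) \<longlonglongrightarrow> 0" "(\<lambda>T. P * (n0\<^sup>2 * (sigma_hi\<^sup>2 * V)) / K T) \<longlonglongrightarrow> 0"
        by (rule real_tendsto_divide_at_top[OF tendsto_const K_top])+
      have "P > 0" by (simp add: P_def)
      then have "filterlim (\<lambda>T. real T * (\<kappa> / (2 * P\<^sup>2))\<^sup>2) at_top sequentially"
        using \<kappa>(1) by (intro filterlim_at_top_mult_tendsto_pos[OF tendsto_const _ filterlim_real_sequentially]) simp
      then show "(\<lambda>T. 4 / (real T * (\<kappa> / (2 * P\<^sup>2))\<^sup>2)) \<longlonglongrightarrow> 0"
        by (rule real_tendsto_divide_at_top[OF tendsto_const])
    qed
    then have r: "r \<longlonglongrightarrow> 0" by simp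
    have K_small: "\<forall>\<^sub>F T in sequentially. 16 / (\<kappa>\<^sup>2 * (\<delta> / 2)\<^sup>2) \<le> sqrt (real (w T))"
      using sqrt_w by (simp add: filterlim_at_top)
    have "\<forall>\<^sub>F T in sequentially. \<exists>A\<in>sets (M T). measure (M T) A \<le> r T \<and>
      (\<forall>\<omega>\<in>space (M T) - A. \<forall>l\<in>L T. \<bar>a T \<omega> l - block_mu (M T) (w T) (\<nu> T) l\<bar> \<le> \<delta>)"
      using late K_small
    proof eventually_elim
      case (elim T)
      then have T: "T0 \<le> T" "1 \<le> T" by auto
      interpret k_sample_regression "M T" "T * n0" "k T" "N T" "c T" "\<sigma> T" F \<beta>
        mu_lo mu_hi sigma_lo sigma_hi "x T" "\<nu> T" "\<epsilon> T" "y T"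
        by (rule model[OF T(1)])
      obtain s where "window_regression (M T) n0 T F (x T) noise s sigma_hi"
        using ex_window_regression[OF n0 T(2) refl sq] by blast
      then interpret W: window_regression "M T" n0 T F "x T" noise s sigma_hi .
      have w: "1 \<le> w T" "w T \<le> T * n0" using w_range[OF T(1)] n0 by auto
      define \<mu> where "\<mu> j = mean_intercept (j * n0)" for j
      have m: "mean_intercept i = \<mu> j" if j: "j \<in> {1..T}" and i: "i \<in> window n0 j" for i j
      proof -
        obtain J where J: "J \<in> {1..k T}" "window n0 j \<subseteq> sample_indices (N T) J"
        proof (rule window_in_one_sample[OF _ total_size _ j])
          show "1 \<le> n0" using n0 by simp
          show "n0 dvd N T j" if "j \<in> {1..k T}" for j using sizes[OF T(1) that] by blast
        qed
        have "j * n0 \<in> window n0 j" using j n0 by (cases j) (auto simp: window_def)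
        then have "mean_intercept (j * n0) = c T J" "mean_intercept i = c T J"
          using intercept_AE_const(2)[OF J(1)] J(2) window_subset[OF j] i by blast+
        then show ?thesis by (simp add: \<mu>_def)
      qed
      have "(K T)\<^sup>2 = sqrt (real (w T))" by (simp add: K_def)
      then have "(K T)\<^sup>2 / ((\<kappa> / 4)\<^sup>2 * real (w T)) = 16 / (\<kappa>\<^sup>2 * sqrt (real (w T)))"
        using w \<kappa>(1) by (simp add: field_simps power2_eq_square)
      also have "\<dots> \<le> (\<delta> / 2)\<^sup>2"
        using elim(2) w \<kappa>(1) \<delta> by (simp add: field_simps)
      finally have K2: "(K T)\<^sup>2 / ((\<kappa> / 4)\<^sup>2 * real (w T)) \<le> (\<delta> / 2)\<^sup>2" .
      have K1: "0 < K T" using w by (simp add: K_def)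
      obtain A where A: "A \<in> sets (M T)" "prob A \<le> W.failure_bound (w T) \<delta> \<kappa> (K T)"
        "\<And>\<omega> l. \<omega> \<in> space (M T) - A \<Longrightarrow> l \<in> {1..T * n0 - w T + 1} \<Longrightarrow>
          \<bar>block_intercept (w T) (\<lambda>i. x T i \<omega>) (\<lambda>i. y T i \<omega>) (beta_EM T \<omega>) l
            - (1 / real (w T)) * (\<Sum>i=l..l+w T-1. mean_intercept i)\<bar> \<le> \<delta>"
      proof (rule W.block_intercepts_uniformly_close[OF \<kappa> w \<delta> K1 K2])
        show "y T i \<omega> = x T i \<omega> \<bullet> \<beta> + mean_intercept i + noise i \<omega>" for i \<omega>
          by (simp add: noise_def)
        show "\<And>j i. j \<in> {1..T} \<Longrightarrow> i \<in> window n0 j \<Longrightarrow> mean_intercept i = \<mu> j" by (rule m)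
        show "\<And>\<omega>. \<omega> \<in> space (M T) \<Longrightarrow> invertible (within_scatter n0 T (\<lambda>i. x T i \<omega>)) \<Longrightarrow>
          is_EM_solution n0 T (\<lambda>i. x T i \<omega>) (\<lambda>i. y T i \<omega>) (beta_EM T \<omega>)"
          by (rule beta_EM[OF T(1)])
      qed blast
      have "W.failure_bound (w T) \<delta> \<kappa> (K T) = r T"
        by (simp add: W.failure_bound_def r_def W.mean_sq_def V_def P_def)
      then show ?case
        using A unfolding L_def a_def block_mu_def mean_intercept_def by (intro bexI[of _ A]) auto
    qed
    with r show ?thesis by blast
  qed

  have prob: "\<forall>\<^sub>F T in sequentially. prob_space (M T)"
    using late by eventually_elim (use model in \<open>auto simp: k_sample_regression_def\<close>)
  have a_meas: "\<forall>\<^sub>F T in sequentially. \<forall>l\<in>L T. (\<lambda>\<omega>. a T \<omega> l) \<in> borel_measurable (M T)"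
    using late
  proof eventually_elim
    case (elim T)
    then have T: "T0 \<le> T" by auto
    interpret k_sample_regression "M T" "T * n0" "k T" "N T" "c T" "\<sigma> T" F \<beta>
      mu_lo mu_hi sigma_lo sigma_hi "x T" "\<nu> T" "\<epsilon> T" "y T"
      by (rule model[OF T])
    have w: "0 < w T" "w T \<le> T * n0" using w_range[OF T] by auto
    have x: "x T i \<in> borel_measurable (M T)" if "i \<in> {1..T * n0}" for i
      using indep_within[OF that] by (simp add: indep_triple_def)
    have y: "y T i \<in> borel_measurable (M T)" if "i \<in> {1..T * n0}" for i
    proof -
      have 1: "snd \<in> borel_measurable (borel :: ((real ^ 'p) \<times> real) measure)"
        by (intro borel_measurable_continuous_onI continuous_intros)
      have 2: "(\<lambda>\<omega>. (x T i \<omega>, y T i \<omega>)) \<in> borel_measurable (M T)"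
        using indep_across that by (simp add: indep_vars_def)
      show ?thesis using measurable_compose[OF 2 1] by simp
    qed
    show ?case
      unfolding a_def block_intercept_eq[OF w(1)]
    proof (intro ballI borel_measurable_divide borel_measurable_sum borel_measurable_diff
        borel_measurable_inner borel_measurable_const beta_EM_measurable[OF T] x y)
    qed (use w in \<open>auto simp: L_def\<close>)
  qed

  \<comment> \<open>\<open>opt\<close> stands for \<open>Max\<close> or \<open>Min\<close>.\<close>
  have opt: "conv_prob_zero M (\<lambda>T \<omega>. opt (a T \<omega> ` L T) - opt (block_mu (M T) (w T) (\<nu> T) ` L T))"
    if lipschitz: "\<And>(I :: nat set) f g d. finite I \<Longrightarrow> I \<noteq> {} \<Longrightarrow> (\<And>i. i \<in> I \<Longrightarrow> \<bar>f i - g i\<bar> \<le> d)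
        \<Longrightarrow> \<bar>opt (f ` I) - opt (g ` I)\<bar> \<le> d"
      and meas: "\<And>(I :: nat set) f (Q :: 'a measure). finite I \<Longrightarrow> (\<And>i. i \<in> I \<Longrightarrow> f i \<in> borel_measurable Q)
        \<Longrightarrow> (\<lambda>\<omega>. opt ((\<lambda>i. f i \<omega>) ` I)) \<in> borel_measurable Q"
    for opt :: "real set \<Rightarrow> real"
  proof (rule conv_prob_zeroI[OF prob])
    show "\<forall>\<^sub>F T in sequentially. (\<lambda>\<omega>. opt (a T \<omega> ` L T) - opt (block_mu (M T) (w T) (\<nu> T) ` L T))
        \<in> borel_measurable (M T)"
      using a_meas
    proof eventually_elim
      case (elim T)
      then have "(\<lambda>\<omega>. opt ((\<lambda>l. a T \<omega> l) ` L T)) \<in> borel_measurable (M T)"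
        by (intro meas[where f = "\<lambda>l \<omega>. a T \<omega> l"] L) blast
      then show ?case by simp
    qed
    fix \<delta> :: real assume "0 < \<delta>"
    then obtain r where r: "r \<longlonglongrightarrow> 0" and ev: "\<forall>\<^sub>F T in sequentially. \<exists>A\<in>sets (M T). measure (M T) A \<le> r T \<and>
        (\<forall>\<omega>\<in>space (M T) - A. \<forall>l\<in>L T. \<bar>a T \<omega> l - block_mu (M T) (w T) (\<nu> T) l\<bar> \<le> \<delta>)"
      using close by blast
    from ev have "\<forall>\<^sub>F T in sequentially. \<exists>A\<in>sets (M T). measure (M T) A \<le> r T \<and>
        (\<forall>\<omega>\<in>space (M T) - A. \<bar>opt (a T \<omega> ` L T) - opt (block_mu (M T) (w T) (\<nu> T) ` L T)\<bar> \<le> \<delta>)"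
    proof eventually_elim
      case (elim T)
      then obtain A where A: "A \<in> sets (M T)" "measure (M T) A \<le> r T"
        "\<And>\<omega> l. \<omega> \<in> space (M T) - A \<Longrightarrow> l \<in> L T \<Longrightarrow> \<bar>a T \<omega> l - block_mu (M T) (w T) (\<nu> T) l\<bar> \<le> \<delta>"
        by blast
      show ?case
      proof (intro bexI[of _ A] conjI ballI A(1,2))
        fix \<omega> assume "\<omega> \<in> space (M T) - A"
        then show "\<bar>opt (a T \<omega> ` L T) - opt (block_mu (M T) (w T) (\<nu> T) ` L T)\<bar> \<le> \<delta>"
          by (intro lipschitz L A(3))
      qed
    qed
    with r show "\<exists>r. r \<longlonglongrightarrow> 0 \<and> (\<forall>\<^sub>F T in sequentially. \<exists>A\<in>sets (M T). measure (M T) A \<le> r T \<and>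
        (\<forall>\<omega>\<in>space (M T) - A. \<bar>opt (a T \<omega> ` L T) - opt (block_mu (M T) (w T) (\<nu> T) ` L T)\<bar> \<le> \<delta>))"
      by blast
  qed
  have "conv_prob_zero M (\<lambda>T \<omega>. Max (a T \<omega> ` L T) - Max (block_mu (M T) (w T) (\<nu> T) ` L T))"
    by (rule opt) (fact abs_Max_diff_le, fact borel_measurable_Max)
  moreover have "conv_prob_zero M (\<lambda>T \<omega>. Min (a T \<omega> ` L T) - Min (block_mu (M T) (w T) (\<nu> T) ` L T))"
    by (rule opt) (fact abs_Min_diff_le, fact borel_measurable_Min)
  ultimately show ?thesis
    unfolding EMMB_upper_def EMMB_lower_def robust_upper_def robust_lower_def a_def L_def by simp
qed

end
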